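(* Let $k\in\mathbb N_{\ge1}$ and let $K,M,N,T\in\mathcal B_{\ge1}^+\subseteq\mathcal L_k$, $N\ne0$, be such that $\mathrm{ord}(T)\ge\mathrm{ord}\big(\frac{D_1(N)}N\big)$, $\mathrm{ord}(K)>(0,\mathbf 1_k)$ and $\mathrm{ord}(M)-\mathrm{ord}(N)>(0,\mathbf 1_k)$. Let $h\in x^2\mathbb R[[x]]$ be a formal power series in the variable $x$ with real coefficients (so $h(0)=h'(0)=0$). Then there exists a unique $S\in\mathcal B_{\ge1}^+\subseteq\mathcal L_k$ with $\mathrm{ord}(S)>\mathrm{ord}(N)$ satisfying the differential equation $$D_1(S)-\Big(\frac{D_1(N)}N+K\Big)\cdot S+T\cdot h(S)=M.$$
   Context: $z$ is a formal variable, $\boldsymbol\ell_1:=-\frac1{\log z}$, $\boldsymbol\ell_{j+1}:=\boldsymbol\ell_j\circ\boldsymbol\ell_1=-\frac1{\log\boldsymbol\ell_j}$. $\mathcal L_k^\infty$ is the field of formal sums $\sum a_{\alpha,n_1,\dots,n_k}z^\alpha\boldsymbol\ell_1^{n_1}\cdots\boldsymbol\ell_k^{n_k}$ over $\mathbb R\times\mathbb Z^k$, with real coefficients and support (set of exponent vectors with nonzero coefficient) well-ordered lexicographically; $\mathrm{ord}(f)$ is the lexicographic minimum of the support, $\mathrm{ord}(0)=\infty$ (larger than every exponent vector, also after subtracting a vector). $\mathcal L_k$ consists of the $f$ with $\mathrm{ord}(f)>\mathbf 0_{k+1}$. $\mathbf 0_j,\mathbf 1_j$ are the vectors of $j$ zeros,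 resp. ones; exponent vectors are added, subtracted and compared as vectors in $\mathbb R\times\mathbb Z^k$ with lexicographic order. $\mathcal B_1\subseteq\mathcal L_k^\infty$ is the set of elements not involving $z$, i.e. of the form $\sum a_{n_1,\dots,n_k}\boldsymbol\ell_1^{n_1}\cdots\boldsymbol\ell_k^{n_k}$, and $\mathcal B_{\ge1}^+:=\{R\in\mathcal B_1:\mathrm{ord}(R)>\mathbf 0_{k+1}\}$. $D_1:=\boldsymbol\ell_1^2\frac{d}{d\boldsymbol\ell_1}$ is the termwise derivation of $\mathcal B_1$ with $D_1(\boldsymbol\ell_1)=\boldsymbol\ell_1^2$, $D_1(\boldsymbol\ell_{j+1})=\boldsymbol\ell_1\cdots\boldsymbol\ell_j\boldsymbol\ell_{j+1}^2$ (equivalently $z\frac d{dz}$). For $S\in\mathcal B_{\ge1}^+$ and $h=\sum_{i\ge2}h_ix^i$, $h(S):=\sum_{i\ge2}h_iS^i$ (coefficientwise convergent). *)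

theory Defs
  imports
    "HOL-Library.Product_Lexorder"
    "HOL-Library.Product_Plus"
    "HOL-Library.Poly_Mapping"
    "HOL-Library.Extended"
    "HOL-Computational_Algebra.Formal_Power_Series"
begin

instance prod :: (linordered_ab_group_add, linordered_ab_group_add) linordered_ab_group_add
  by standard (auto simp: less_eq_prod_def)

lemma wfp_on_less_iff_no_descent:
  "wfp_on A ((<) :: 'a::linorder \<Rightarrow> 'a \<Rightarrow> bool)
     \<longleftrightarrow> \<not> (\<exists>s::nat \<Rightarrow> 'a. \<forall>n. s n \<in> A \<and> s (Suc n) < s n)"
proof
  assume wf: "wfp_on A ((<) :: 'a \<Rightarrow> 'a \<Rightarrow> bool)"
  show "\<not> (\<exists>s::nat \<Rightarrow> 'a. \<forall>n. s n \<in> A \<and> s (Suc n) < s n)"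
  proof
    assume "\<exists>s::nat \<Rightarrow> 'a. \<forall>n. s n \<in> A \<and> s (Suc n) < s n"
    then obtain s :: "nat \<Rightarrow> 'a" where s: "\<And>n. s n \<in> A" "\<And>n. s (Suc n) < s n" by blast
    then have "range s \<subseteq> A" "range s \<noteq> {}" by auto
    then obtain z where "z \<in> range s" "\<forall>y. y < z \<longrightarrow> y \<notin> range s"
      using wf unfolding wfp_on_iff_ex_minimal by meson
    then show False using s(2) by blast
  qed
next
  assume nd: "\<not> (\<exists>s::nat \<Rightarrow> 'a. \<forall>n. s n \<in> A \<and> s (Suc n) < s n)"
  show "wfp_on A ((<) :: 'a \<Rightarrow> 'a \<Rightarrow> bool)"
    unfolding wfp_on_iff_ex_minimal
  proof (intro allI impI, rule ccontr)
    fix B assume B: "B \<subseteq> A" "B \<noteq> {}" and "\<not> (\<exists>z\<in>B. \<forall>y. y < z \<longrightarrow> y \<notin> B)"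
    then have step: "\<exists>y. y \<in> B \<and> y < z" if "z \<in> B" for z using that by blast
    obtain b where "b \<in> B" using B by blast
    then have "\<exists>s. \<forall>n. s n \<in> B \<and> s (Suc n) < s n"
      using dependent_nat_choice[of "\<lambda>_ x. x \<in> B" "\<lambda>_ x y. y < x"] step by blast
    then show False using nd B by blast
  qed
qed

lemma wfp_on_less_minimum:
  fixes A :: "'a::linorder set"
  assumes "wfp_on A (<)" "B \<subseteq> A" "B \<noteq> {}"
  obtains m where "m \<in> B" "\<And>b. b \<in> B \<Longrightarrow> m \<le> b"
  using assms unfolding wfp_on_iff_ex_minimal by (metis not_le)

lemma wfp_on_less_monosub:
  fixes s :: "nat \<Rightarrow> 'a::linorder"
  assumes wf: "wfp_on A (<)" and s: "\<And>n. s n \<in> A"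
  obtains r :: "nat \<Rightarrow> nat" where "strict_mono r" "incseq (\<lambda>n. s (r n))"
proof -
  obtain r :: "nat \<Rightarrow> nat" where r: "strict_mono r" "monoseq (\<lambda>n. s (r n))"
    using seq_monosub[of s] by blast
  show thesis
  proof (cases "incseq (\<lambda>n. s (r n))")
    case False
    then have dec: "decseq (\<lambda>n. s (r n))" using r(2) by (simp add: monoseq_iff)
    have "range (\<lambda>n. s (r n)) \<subseteq> A" "range (\<lambda>n. s (r n)) \<noteq> {}" using s by auto
    then obtain m where "m \<in> range (\<lambda>n. s (r n))" "\<And>b. b \<in> range (\<lambda>n. s (r n)) \<Longrightarrow> m \<le> b"
      by (rule wfp_on_less_minimum[OF wf]) (rule that)
    then obtain N where N: "\<And>n. s (r N) \<le> s (r n)" by blast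
    have const: "s (r (n + N)) = s (r N)" for n
      using decseqD[OF dec, of N "n + N"] N[of "n + N"] by (simp add: antisym)
    have "strict_mono (\<lambda>n. r (n + N))" using r(1) by (simp add: strict_mono_def)
    moreover have "incseq (\<lambda>n. s (r (n + N)))" by (simp add: const)
    ultimately show thesis by (rule that)
  qed (use r that in blast)
qed

lemma wfp_on_less_plus:
  fixes A B :: "'a::linordered_ab_group_add set"
  assumes A: "wfp_on A (<)" and B: "wfp_on B (<)"
  shows "wfp_on {a + b | a b. a \<in> A \<and> b \<in> B} (<)"
  unfolding wfp_on_less_iff_no_descent
proof
  assume "\<exists>s::nat \<Rightarrow> 'a. \<forall>n. s n \<in> {a + b | a b. a \<in> A \<and> b \<in> B} \<and> s (Suc n) < s n"
  then obtain s :: "nat \<Rightarrow> 'a" where s: "\<forall>n. \<exists>a b. s n = a + b \<and> a \<in> A \<and> b \<in> B"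
    and dec: "\<And>n. s (Suc n) < s n" by auto
  from s obtain a b where ab: "\<And>n. s n = a n + b n" "\<And>n. a n \<in> A" "\<And>n. b n \<in> B"
    by metis
  obtain r :: "nat \<Rightarrow> nat" where r: "strict_mono r" "incseq (\<lambda>n. a (r n))"
    using wfp_on_less_monosub[OF A, of a] ab by blast
  have "b (r (Suc n)) < b (r n)" for n
  proof -
    have "s (r (Suc n)) < s (r n)"
      using lift_Suc_mono_less[of "\<lambda>n. - s n" "r n" "r (Suc n)"] dec r(1) by (simp add: strict_mono_def)
    moreover have "a (r n) \<le> a (r (Suc n))" using incseq_SucD[OF r(2), of n] .
    ultimately show ?thesis
      unfolding ab(1) by (metis add_mono not_le)
  qed
  then have "\<exists>s::nat \<Rightarrow> 'a. \<forall>n. s n \<in> B \<and> s (Suc n) < s n"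
    using ab(3) by (intro exI[of _ "\<lambda>n. b (r n)"]) auto
  then show False using B unfolding wfp_on_less_iff_no_descent by blast
qed

lemma plus_set_memI:
  fixes c :: "'a::ab_group_add"
  shows "a \<in> A \<Longrightarrow> c - a \<in> B \<Longrightarrow> c \<in> {a + b | a b. a \<in> A \<and> b \<in> B}"
  by (rule CollectI, rule exI[of _ a], rule exI[of _ "c - a"]) simp

lemma finite_wfp_on_less_fibre:
  fixes A B :: "'a::linordered_ab_group_add set"
  assumes A: "wfp_on A (<)" and B: "wfp_on B (<)"
  shows "finite {a \<in> A. c - a \<in> B}"
proof (rule ccontr)
  assume "infinite {a \<in> A. c - a \<in> B}"
  then obtain s :: "nat \<Rightarrow> 'a" where s: "inj s" "range s \<subseteq> {a \<in> A. c - a \<in> B}"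
    using infinite_countable_subset by blast
  obtain r :: "nat \<Rightarrow> nat" where r: "strict_mono r" "incseq (\<lambda>n. s (r n))"
    using wfp_on_less_monosub[OF A, of s] s by blast
  have "c - s (r (Suc n)) < c - s (r n)" for n
  proof -
    have "s (r n) \<noteq> s (r (Suc n))"
      using s(1) r(1) by (metis injD n_not_Suc_n strict_mono_eq)
    then show ?thesis using incseq_SucD[OF r(2), of n] by (simp add: order_less_le)
  qed
  then have "\<exists>t::nat \<Rightarrow> 'a. \<forall>n. t n \<in> B \<and> t (Suc n) < t n"
    using s(2) by (intro exI[of _ "\<lambda>n. c - s (r n)"]) auto
  then show False using B unfolding wfp_on_less_iff_no_descent by blast
qed

lemma wfp_on_less_Un:
  fixes A B :: "'a::linorder set"
  assumes A: "wfp_on A (<)" and B: "wfp_on B (<)"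
  shows "wfp_on (A \<union> B) (<)"
  unfolding wfp_on_iff_ex_minimal
proof (intro allI impI)
  fix C assume C: "C \<subseteq> A \<union> B" "C \<noteq> {}"
  show "\<exists>z\<in>C. \<forall>y. y < z \<longrightarrow> y \<notin> C"
  proof (cases "C \<inter> A = {}")
    case True
    then have "C \<subseteq> B" using C by blast
    with B C show ?thesis unfolding wfp_on_iff_ex_minimal by blast
  next
    case False
    then obtain a where a: "a \<in> C \<inter> A" "\<And>x. x \<in> C \<inter> A \<Longrightarrow> a \<le> x"
      using wfp_on_less_minimum[OF A, of "C \<inter> A"] by blast
    show ?thesis
    proof (cases "{x \<in> C \<inter> B. x < a} = {}")
      case True
      then show ?thesis using a C by (intro bexI[of _ a]) fastforce+
    next
      case False
      then obtain b where b: "b \<in> {x \<in> C \<inter> B. x < a}" "\<And>x. x \<in> {x \<in> C \<inter> B. x < a} \<Longrightarrow> b \<le> x"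
        using wfp_on_less_minimum[OF B, of "{x \<in> C \<inter> B. x < a}"] by blast
      then have "\<forall>y. y < b \<longrightarrow> y \<notin> C" using a C by fastforce
      then show ?thesis using b by blast
    qed
  qed
qed

lemma wfp_on_less_UN_finite:
  fixes A :: "'i \<Rightarrow> 'a::linorder set"
  assumes "finite I" "\<And>i. i \<in> I \<Longrightarrow> wfp_on (A i) (<)"
  shows "wfp_on (\<Union>i\<in>I. A i) (<)"
  using assms
proof (induction I rule: finite_induct)
  case empty
  then show ?case by (simp add: wfp_on_iff_ex_minimal)
qed (simp add: wfp_on_less_Un)

lemma wfp_on_less_finite:
  fixes A :: "'a::linorder set"
  assumes "finite A"
  shows "wfp_on A (<)"
proof -
  have "wfp_on (\<Union>i\<in>A. {i}) (<)"
    by (rule wfp_on_less_UN_finite[OF assms]) (auto simp: wfp_on_iff_ex_minimal)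
  then show ?thesis by simp
qed

typedef (overloaded) 'a hahn =
  "{f :: 'a::linorder \<Rightarrow> real. wfp_on {a. f a \<noteq> 0} (<)}"
  morphisms hcoeff Abs_hahn
  by (rule exI[of _ "\<lambda>_. 0"]) (simp add: wfp_on_iff_ex_minimal)

setup_lifting type_definition_hahn

definition hsupp :: "'a::linorder hahn \<Rightarrow> 'a set" where
  "hsupp f = {a. hcoeff f a \<noteq> 0}"

lemma wfp_on_hsupp: "wfp_on (hsupp f) (<)"
  using hcoeff[of f] by (simp add: hsupp_def)

lemma hahn_eqI: "(\<And>a. hcoeff f a = hcoeff g a) \<Longrightarrow> f = g"
  by (simp add: hcoeff_inject[symmetric] fun_eq_iff)

lift_definition hmonom :: "real \<Rightarrow> 'a::linorder \<Rightarrow> 'a hahn" is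
  "\<lambda>c a b. if b = a then c else 0"
  by (rule wfp_on_less_finite) auto

text \<open>The order of vanishing; the value \<open>\<infinity>\<close> at \<open>0\<close> satisfies \<open>\<infinity> - Fin a = \<infinity>\<close>.\<close>

definition hord :: "'a::linorder hahn \<Rightarrow> 'a extended" where
  "hord f = (if hsupp f = {} then \<infinity> else Fin (LEAST a. a \<in> hsupp f))"

instantiation hahn :: (linorder) ab_group_add
begin

lift_definition zero_hahn :: "'a hahn" is "\<lambda>_. 0"
  by (simp add: wfp_on_iff_ex_minimal)

lift_definition plus_hahn :: "'a hahn \<Rightarrow> 'a hahn \<Rightarrow> 'a hahn" is "\<lambda>f g a. f a + g a"
  by (erule (1) wfp_on_subset[OF wfp_on_less_Un]) auto

lift_definition uminus_hahn :: "'a hahn \<Rightarrow> 'a hahn" is "\<lambda>f a. - f a"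
  by simp

lift_definition minus_hahn :: "'a hahn \<Rightarrow> 'a hahn \<Rightarrow> 'a hahn" is "\<lambda>f g a. f a - g a"
  by (erule (1) wfp_on_subset[OF wfp_on_less_Un]) auto

instance
proof
  fix f g h :: "'a hahn"
  show "f + g + h = f + (g + h)" by (rule hahn_eqI) (simp add: plus_hahn.rep_eq)
  show "f + g = g + f" by (rule hahn_eqI) (simp add: plus_hahn.rep_eq)
  show "0 + f = f" by (rule hahn_eqI) (simp add: plus_hahn.rep_eq zero_hahn.rep_eq)
  show "- f + f = 0"
    by (rule hahn_eqI) (simp add: plus_hahn.rep_eq zero_hahn.rep_eq uminus_hahn.rep_eq)
  show "f - g = f + - g"
    by (rule hahn_eqI) (simp add: plus_hahn.rep_eq minus_hahn.rep_eq uminus_hahn.rep_eq)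
qed

end

declare zero_hahn.rep_eq [simp] plus_hahn.rep_eq [simp] uminus_hahn.rep_eq [simp]
  minus_hahn.rep_eq [simp]

lemma hsupp_eq_empty_iff: "hsupp f = {} \<longleftrightarrow> f = 0"
  by (auto simp: hsupp_def intro: hahn_eqI)

lemma hsupp_least:
  assumes "f \<noteq> 0"
  obtains a where "a \<in> hsupp f" "\<And>b. b \<in> hsupp f \<Longrightarrow> a \<le> b" "hord f = Fin a"
proof -
  obtain a where a: "a \<in> hsupp f" "\<And>b. b \<in> hsupp f \<Longrightarrow> a \<le> b"
    using wfp_on_less_minimum[OF wfp_on_hsupp order_refl, of f] assms hsupp_eq_empty_iff by blast
  then have "(LEAST a. a \<in> hsupp f) = a" by (auto intro: Least_equality)
  then have "hord f = Fin a" using a by (auto simp: hord_def)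
  with a that show thesis by blast
qed

instantiation hahn :: (linordered_ab_group_add) comm_ring_1
begin

definition one_hahn :: "'a hahn" where "1 = hmonom 1 0"

lift_definition times_hahn :: "'a hahn \<Rightarrow> 'a hahn \<Rightarrow> 'a hahn" is
  "\<lambda>f g c. \<Sum>a | f a \<noteq> 0 \<and> g (c - a) \<noteq> 0. f a * g (c - a)"
proof -
  fix f g :: "'a \<Rightarrow> real"
  assume "wfp_on {a. f a \<noteq> 0} (<)" "wfp_on {a. g a \<noteq> 0} (<)"
  then have "wfp_on {a + b | a b. a \<in> {a. f a \<noteq> 0} \<and> b \<in> {b. g b \<noteq> 0}} (<)"
    by (rule wfp_on_less_plus)
  then show "wfp_on {c. (\<Sum>a | f a \<noteq> 0 \<and> g (c - a) \<noteq> 0. f a * g (c - a)) \<noteq> 0} (<)"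
  proof (rule wfp_on_subset, intro subsetI)
    fix c assume "c \<in> {c. (\<Sum>a | f a \<noteq> 0 \<and> g (c - a) \<noteq> 0. f a * g (c - a)) \<noteq> 0}"
    then obtain a where "f a \<noteq> 0" "g (c - a) \<noteq> 0" by (auto elim: sum.not_neutral_contains_not_neutral)
    then show "c \<in> {a + b | a b. a \<in> {a. f a \<noteq> 0} \<and> b \<in> {b. g b \<noteq> 0}}"
      using plus_set_memI[of a "{a. f a \<noteq> 0}" c "{b. g b \<noteq> 0}"] by simp
  qed
qed

lemma finite_hahn_fibre: "finite {a. hcoeff f a \<noteq> 0 \<and> hcoeff g (c - a) \<noteq> 0}"
  for f g :: "'a hahn"
  using finite_wfp_on_less_fibre[OF wfp_on_hsupp wfp_on_hsupp, of f c g] by (simp add: hsupp_def)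

lemma hcoeff_times_superset:
  fixes f g :: "'a hahn"
  assumes "finite F" "\<And>a. hcoeff f a \<noteq> 0 \<Longrightarrow> hcoeff g (c - a) \<noteq> 0 \<Longrightarrow> a \<in> F"
  shows "hcoeff (f * g) c = (\<Sum>a\<in>F. hcoeff f a * hcoeff g (c - a))"
  unfolding times_hahn.rep_eq
proof (rule sum.mono_neutral_left)
  show "{a. hcoeff f a \<noteq> 0 \<and> hcoeff g (c - a) \<noteq> 0} \<subseteq> F" using assms(2) by blast
qed (simp_all add: assms(1))

lemma hahn_mult_comm: "f * g = g * f" for f g :: "'a hahn"
proof (rule hahn_eqI)
  fix c
  show "hcoeff (f * g) c = hcoeff (g * f) c"
    unfolding times_hahn.rep_eq
    by (rule sum.reindex_bij_witness[of _ "\<lambda>a. c - a" "\<lambda>a. c - a"]) auto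
qed

lemma hahn_distrib: "(f + g) * h = f * h + g * h" for f g h :: "'a hahn"
proof (rule hahn_eqI)
  fix c
  let ?F = "{a. hcoeff f a \<noteq> 0 \<and> hcoeff h (c - a) \<noteq> 0} \<union> {a. hcoeff g a \<noteq> 0 \<and> hcoeff h (c - a) \<noteq> 0}"
  have fin: "finite ?F" using finite_hahn_fibre by blast
  have "hcoeff ((f + g) * h) c = (\<Sum>a\<in>?F. hcoeff (f + g) a * hcoeff h (c - a))"
    using fin by (rule hcoeff_times_superset) auto
  moreover have "hcoeff (f * h) c = (\<Sum>a\<in>?F. hcoeff f a * hcoeff h (c - a))"
    using fin by (rule hcoeff_times_superset) auto
  moreover have "hcoeff (g * h) c = (\<Sum>a\<in>?F. hcoeff g a * hcoeff h (c - a))"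
    using fin by (rule hcoeff_times_superset) auto
  ultimately show "hcoeff ((f + g) * h) c = hcoeff (f * h + g * h) c"
    by (simp only: plus_hahn.rep_eq sum.distrib distrib_right)
qed

lemma hahn_mult_assoc: "(f * g) * h = f * (g * h)" for f g h :: "'a hahn"
proof (rule hahn_eqI)
  fix c
  define U where "U = {u \<in> {a + b | a b. a \<in> hsupp f \<and> b \<in> hsupp g}. c - u \<in> hsupp h}"
  define A where "A = {a \<in> hsupp f. c - a \<in> {a + b | a b. a \<in> hsupp g \<and> b \<in> hsupp h}}"
  let ?V = "\<lambda>u. {a. hcoeff f a \<noteq> 0 \<and> hcoeff g (u - a) \<noteq> 0}"
  let ?B = "\<lambda>a. {b. hcoeff g b \<noteq> 0 \<and> hcoeff h (c - a - b) \<noteq> 0}"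
  have finU: "finite U" unfolding U_def
    by (intro finite_wfp_on_less_fibre wfp_on_less_plus wfp_on_hsupp)
  have finA: "finite A" unfolding A_def
    by (intro finite_wfp_on_less_fibre wfp_on_less_plus wfp_on_hsupp)
  have memU: "x \<in> U" if "hcoeff f a \<noteq> 0" "hcoeff g (x - a) \<noteq> 0" "hcoeff h (c - x) \<noteq> 0" for x a
    using plus_set_memI[of a "hsupp f" x "hsupp g"] that by (simp add: U_def hsupp_def)
  have memA: "a \<in> A" if "hcoeff f a \<noteq> 0" "hcoeff g b \<noteq> 0" "hcoeff h (c - a - b) \<noteq> 0" for a b
    using plus_set_memI[of b "hsupp g" "c - a" "hsupp h"] that by (simp add: A_def hsupp_def)
  have neq: "\<exists>a. hcoeff f a \<noteq> 0 \<and> hcoeff g (x - a) \<noteq> 0" if "hcoeff (f * g) x \<noteq> 0"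
    for x and f g :: "'a hahn"
    using that unfolding times_hahn.rep_eq by (auto elim: sum.not_neutral_contains_not_neutral)
  have "hcoeff (f * g * h) c = (\<Sum>u\<in>U. hcoeff (f * g) u * hcoeff h (c - u))"
    by (rule hcoeff_times_superset[OF finU]) (use neq memU in blast)
  also have "\<dots> = (\<Sum>u\<in>U. \<Sum>a\<in>?V u. hcoeff f a * hcoeff g (u - a) * hcoeff h (c - u))"
    by (simp add: times_hahn.rep_eq sum_distrib_right)
  also have "\<dots> = (\<Sum>(u, a)\<in>Sigma U ?V. hcoeff f a * hcoeff g (u - a) * hcoeff h (c - u))"
    using finU finite_hahn_fibre by (subst sum.Sigma) auto
  also have "\<dots> = (\<Sum>(a, b)\<in>Sigma A ?B. hcoeff f a * (hcoeff g b * hcoeff h (c - a - b)))"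
  proof (rule sum.reindex_bij_witness[of _ "\<lambda>(a, b). (a + b, a)" "\<lambda>(u, a). (a, u - a)"])
    fix p assume p: "p \<in> Sigma U ?V"
    obtain u a where [simp]: "p = (u, a)" by (cases p)
    have "hcoeff h (c - u) \<noteq> 0" using p by (auto simp: U_def hsupp_def)
    then show "(case p of (u, a) \<Rightarrow> (a, u - a)) \<in> Sigma A ?B"
      using p by (auto intro!: memA[of a "u - a"])
  next
    fix p assume p: "p \<in> Sigma A ?B"
    obtain a b where [simp]: "p = (a, b)" by (cases p)
    have "hcoeff f a \<noteq> 0" using p by (auto simp: A_def hsupp_def)
    then show "(case p of (a, b) \<Rightarrow> (a + b, a)) \<in> Sigma U ?V"
      using p by (auto intro!: memU[of a "a + b"] simp: diff_diff_eq)
  qed (auto simp: mult.assoc)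
  also have "\<dots> = (\<Sum>a\<in>A. \<Sum>b\<in>?B a. hcoeff f a * (hcoeff g b * hcoeff h (c - a - b)))"
    using finA finite_hahn_fibre by (subst sum.Sigma) auto
  also have "\<dots> = (\<Sum>a\<in>A. hcoeff f a * hcoeff (g * h) (c - a))"
    by (simp add: times_hahn.rep_eq sum_distrib_left)
  also have "\<dots> = hcoeff (f * (g * h)) c"
    by (rule hcoeff_times_superset[OF finA, symmetric]) (use neq memA in blast)
  finally show "hcoeff (f * g * h) c = hcoeff (f * (g * h)) c" .
qed

lemma hcoeff_hmonom_times: "hcoeff (hmonom r a * f) c = r * hcoeff f (c - a)" for f :: "'a hahn"
proof -
  have "hcoeff (hmonom r a * f) c = (\<Sum>b\<in>{a}. hcoeff (hmonom r a) b * hcoeff f (c - b))"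
    by (rule hcoeff_times_superset) (simp_all add: hmonom.rep_eq split: if_splits)
  then show ?thesis by (simp add: hmonom.rep_eq)
qed

instance
proof
  fix f g h :: "'a hahn"
  show "f * g * h = f * (g * h)" by (rule hahn_mult_assoc)
  show "f * g = g * f" by (rule hahn_mult_comm)
  show "(f + g) * h = f * h + g * h" by (rule hahn_distrib)
  show "1 * f = f" by (rule hahn_eqI) (simp add: one_hahn_def hcoeff_hmonom_times)
  have "hcoeff (1 :: 'a hahn) 0 = 1" by (simp add: one_hahn_def hmonom.rep_eq)
  then show "(0 :: 'a hahn) \<noteq> 1" by (metis zero_hahn.rep_eq zero_neq_one)
qed

end

lemma hcoeff_one: "hcoeff (1 :: 'a::linordered_ab_group_add hahn) a = (if a = 0 then 1 else 0)"
  by (simp add: one_hahn_def hmonom.rep_eq)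

lemma hmonom_times_hmonom:
  "hmonom r a * hmonom s b = hmonom (r * s) (a + b :: 'a::linordered_ab_group_add)"
  by (rule hahn_eqI) (simp add: hcoeff_hmonom_times hmonom.rep_eq diff_eq_eq add.commute)

lemma hcoeff_times_leading:
  fixes f d :: "'a::linordered_ab_group_add hahn"
  assumes f: "hcoeff f 0 = 1" "\<And>a. a \<in> hsupp f \<Longrightarrow> 0 \<le> a"
    and d: "\<And>s. s < t \<Longrightarrow> hcoeff d s = 0"
  shows "hcoeff (f * d) t = hcoeff d t"
proof -
  have "hcoeff (f * d) t = (\<Sum>a\<in>{0}. hcoeff f a * hcoeff d (t - a))"
  proof (rule hcoeff_times_superset)
    fix a assume "hcoeff f a \<noteq> 0" "hcoeff d (t - a) \<noteq> 0"
    then have "0 \<le> a" "\<not> t - a < t" using f(2) d by (auto simp: hsupp_def)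
    then show "a \<in> {0}" by simp
  qed simp
  then show ?thesis using f(1) by simp
qed

lemma hahn_unit_inverse_exists:
  fixes f :: "'a::linordered_ab_group_add hahn"
  assumes f: "hcoeff f 0 = 1" "\<And>a. a \<in> hsupp f \<Longrightarrow> 0 \<le> a"
  shows "\<exists>g. f * g = 1"
proof (rule ccontr)
  assume no_inv: "\<nexists>g. f * g = 1"
  note lead = hcoeff_times_leading[OF f]
  define good where
    "good g \<longleftrightarrow> (\<forall>s\<in>hsupp g. \<forall>t\<le>s. hcoeff (f * g) t = hcoeff 1 t)" for g
  have agree: "hcoeff g t = hcoeff g' t"
    if g: "good g" "s \<in> hsupp g" "t \<le> s" and g': "good g'" "s' \<in> hsupp g'" "t \<le> s'" for g g' s s' t
  proof (rule ccontr)
    assume "hcoeff g t \<noteq> hcoeff g' t"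
    then have t: "t \<in> hsupp (g - g')" by (simp add: hsupp_def)
    then have "g - g' \<noteq> 0" using hsupp_eq_empty_iff[of "g - g'"] by blast
    then obtain r where r: "r \<in> hsupp (g - g')" "\<And>b. b \<in> hsupp (g - g') \<Longrightarrow> r \<le> b"
      using hsupp_least by blast
    have "hcoeff (f * (g - g')) r = hcoeff (g - g') r"
    proof (rule lead)
      fix s assume "s < r"
      then have "s \<notin> hsupp (g - g')" using r(2)[of s] by auto
      then show "hcoeff (g - g') s = 0" unfolding hsupp_def by blast
    qed
    moreover have "hcoeff (f * g) r = hcoeff 1 r" "hcoeff (f * g') r = hcoeff 1 r"
      using g g' r(2)[OF t] unfolding good_def by (meson order_trans)+
    ultimately show False using r(1) by (simp add: hsupp_def right_diff_distrib)
  qed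
  define below where "below t g \<longleftrightarrow> good g \<and> (\<exists>s\<in>hsupp g. t \<le> s)" for t g
  define U where "U t = (if \<exists>g. below t g then hcoeff (SOME g. below t g) t else 0)" for t
  have U: "U t = hcoeff g t" if "below t g" for t g
  proof -
    have "below t (SOME g. below t g)" using that by (rule someI)
    then have "hcoeff (SOME g. below t g) t = hcoeff g t"
      using that agree unfolding below_def by blast
    then show ?thesis using that by (auto simp: U_def)
  qed
  have "wfp_on {a. U a \<noteq> 0} (<)"
    unfolding wfp_on_less_iff_no_descent
  proof
    assume "\<exists>s::nat \<Rightarrow> 'a. \<forall>n. s n \<in> {a. U a \<noteq> 0} \<and> s (Suc n) < s n"
    then obtain s :: "nat \<Rightarrow> 'a" where s: "\<And>n. U (s n) \<noteq> 0" "\<And>n. s (Suc n) < s n" by blast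
    have "\<exists>g. below (s 0) g" using s(1)[of 0] by (auto simp: U_def split: if_splits)
    then obtain g where g: "below (s 0) g" by blast
    have "s n \<le> s 0" for n
      using lift_Suc_antimono_le[of s 0 n] s(2) by (simp add: less_imp_le)
    then have "below (s n) g" for n
      using g unfolding below_def by (meson order_trans)
    then have "s n \<in> hsupp g" for n
      using s(1)[of n] U[of "s n" g] by (simp add: hsupp_def)
    then show False
      using s(2) wfp_on_hsupp[of g] unfolding wfp_on_less_iff_no_descent by blast
  qed
  then have cu: "hcoeff (Abs_hahn U) t = U t" for t by (simp add: Abs_hahn_inverse)
  define u where "u = Abs_hahn U"
  have good_u: "good u"
    unfolding good_def
  proof (intro ballI allI impI)
    fix s t assume s: "s \<in> hsupp u" and t: "t \<le> s"
    have "\<exists>g. below s g" using s by (auto simp: hsupp_def u_def cu U_def split: if_splits)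
    then obtain g where g: "below s g" by blast
    have eq: "hcoeff (u - g) x = 0" if "x \<le> t" for x
    proof -
      have "below x g" using g that t unfolding below_def by (meson order_trans)
      then show ?thesis by (simp add: u_def cu U)
    qed
    have "hcoeff (f * (u - g)) t = hcoeff (u - g) t"
    proof (rule lead)
      fix x assume "x < t"
      then show "hcoeff (u - g) x = 0" by (intro eq) simp
    qed
    then have "hcoeff (f * u) t = hcoeff (f * g) t" using eq[of t] by (simp add: right_diff_distrib)
    also have "\<dots> = hcoeff 1 t"
      using g t unfolding below_def good_def by (meson order_trans)
    finally show "hcoeff (f * u) t = hcoeff 1 t" .
  qed
  have "1 - f * u \<noteq> 0" using no_inv by (metis eq_iff_diff_eq_0)
  then obtain r where r: "r \<in> hsupp (1 - f * u)" "\<And>b. b \<in> hsupp (1 - f * u) \<Longrightarrow> r \<le> b"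
    using hsupp_least by blast
  define c where "c = hcoeff (1 - f * u) r"
  have c: "c \<noteq> 0" using r(1) by (simp add: c_def hsupp_def)
  have above: "s < r" if "s \<in> hsupp u" for s
  proof (rule ccontr)
    assume "\<not> s < r"
    then have "hcoeff (f * u) r = hcoeff 1 r" using good_u that unfolding good_def by simp
    then show False using c by (simp add: c_def)
  qed
  then have ur: "hcoeff u r = 0" by (auto simp: hsupp_def)
  define g where "g = u + hmonom c r"
  have "s \<le> r" if "s \<in> hsupp g" for s
    using that above[of s] by (auto simp: g_def hsupp_def hmonom.rep_eq split: if_splits)
  moreover have "hcoeff (f * g) t = hcoeff 1 t" if "t \<le> r" for t
  proof -
    have m: "hcoeff (f * hmonom c r) t = hcoeff (hmonom c r) t"
      using that by (intro lead) (auto simp: hmonom.rep_eq)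
    have "hcoeff (f * g) t = hcoeff (f * u) t + hcoeff (hmonom c r) t"
      using m by (simp add: g_def distrib_left)
    moreover have "hcoeff (1 - f * u) t = 0" if tr: "t < r"
    proof -
      have "t \<notin> hsupp (1 - f * u)" using r(2)[of t] tr by auto
      then show ?thesis unfolding hsupp_def by blast
    qed
    ultimately show ?thesis using \<open>t \<le> r\<close>
      by (cases "t = r") (auto simp: hmonom.rep_eq c_def)
  qed
  ultimately have "good g" unfolding good_def by (meson order_trans)
  moreover have "r \<in> hsupp g" using c ur by (simp add: g_def hsupp_def hmonom.rep_eq)
  ultimately have "below r g" unfolding below_def by blast
  then have "hcoeff u r = hcoeff g r" by (simp add: u_def cu U)
  then show False using c ur by (simp add: g_def hmonom.rep_eq)
qed

lemma hahn_inverse_exists: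
  fixes f :: "'a::linordered_ab_group_add hahn"
  assumes "f \<noteq> 0"
  shows "\<exists>g. f * g = 1"
proof -
  obtain a where a: "a \<in> hsupp f" "\<And>b. b \<in> hsupp f \<Longrightarrow> a \<le> b"
    using assms hsupp_least by blast
  define e where "e = hmonom (1 / hcoeff f a) (- a)"
  have e: "hcoeff (e * f) x = hcoeff f (x + a) / hcoeff f a" for x
    by (simp add: e_def hcoeff_hmonom_times)
  have "\<exists>g. (e * f) * g = 1"
  proof (rule hahn_unit_inverse_exists)
    show "hcoeff (e * f) 0 = 1" using a(1) by (simp add: e hsupp_def)
    fix x assume "x \<in> hsupp (e * f)"
    then have "a \<le> x + a" using a(2)[of "x + a"] by (simp add: hsupp_def e)
    then show "0 \<le> x" by simp
  qed
  then obtain g where "(e * f) * g = 1" ..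
  then have "f * (e * g) = 1" by (simp add: ac_simps)
  then show ?thesis ..
qed

instantiation hahn :: (linordered_ab_group_add) field
begin

definition inverse_hahn :: "'a hahn \<Rightarrow> 'a hahn" where
  "inverse_hahn f = (if f = 0 then 0 else THE g. f * g = 1)"

definition divide_hahn :: "'a hahn \<Rightarrow> 'a hahn \<Rightarrow> 'a hahn" where
  "divide_hahn f g = f * inverse g"

instance
proof
  fix f g :: "'a hahn"
  show "inverse f * f = 1" if f0: "f \<noteq> 0"
  proof -
    obtain g where g: "f * g = 1" using hahn_inverse_exists[OF f0] ..
    have uniq: "g' = g" if "f * g' = 1" for g'
    proof -
      have "g' = (f * g) * g'" using g by simp
      also have "\<dots> = (f * g') * g" by (simp add: ac_simps)
      finally show ?thesis using that by simp
    qed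
    have "(THE g. f * g = 1) = g" using g uniq by (rule the_equality)
    then have "inverse f = g" using f0 by (simp add: inverse_hahn_def)
    then show ?thesis using g by (simp add: mult.commute)
  qed
qed (simp_all add: inverse_hahn_def divide_hahn_def)

end

lemma hord_pos_hsupp: "hord f > Fin 0 \<Longrightarrow> a \<in> hsupp f \<Longrightarrow> 0 < a"
  for f :: "'a::linordered_ab_group_add hahn"
proof -
  assume *: "hord f > Fin 0" "a \<in> hsupp f"
  then have "f \<noteq> 0" by (auto simp: hsupp_def)
  then obtain b where "\<And>c. c \<in> hsupp f \<Longrightarrow> b \<le> c" "hord f = Fin b" using hsupp_least by blast
  with * show "0 < a" by (metis less_extended_simps(1) less_le_trans)
qed

text \<open>Neumann's lemma: the powers of a series of positive order are a summable family. It is read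
  off from the inverse of \<open>1 - S x\<close>, where \<open>x\<close> has the lexicographically negative exponent
  \<open>(0, - 1)\<close>, so that \<open>S x\<close> still has positive order.\<close>

context
begin

private lift_definition tag :: "'a::linordered_ab_group_add hahn \<Rightarrow> ('a \<times> int) hahn" is
  "\<lambda>f (a, m). if m = - 1 then f a else 0"
proof -
  fix f :: "'a \<Rightarrow> real" assume f: "wfp_on {a. f a \<noteq> 0} (<)"
  have "{p. (case p of (a, m::int) \<Rightarrow> if m = - 1 then f a else 0) \<noteq> 0} = (\<lambda>a. (a, - 1)) ` {a. f a \<noteq> 0}"
    by (auto split: if_splits)
  then show "wfp_on {p. (case p of (a, m::int) \<Rightarrow> if m = - 1 then f a else 0) \<noteq> 0} (<)"
    using f by (simp add: wfp_on_image)
qed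

private lift_definition slice :: "int \<Rightarrow> ('a::linordered_ab_group_add \<times> int) hahn \<Rightarrow> 'a hahn" is
  "\<lambda>m f a. f (a, m)"
proof -
  fix m :: int and f :: "'a \<times> int \<Rightarrow> real"
  assume f: "wfp_on {p. f p \<noteq> 0} (<)"
  have "wfp_on ((\<lambda>a. (a, m)) ` {a. f (a, m) \<noteq> 0}) (<)"
    by (rule wfp_on_subset[OF f]) auto
  then show "wfp_on {a. f (a, m) \<noteq> 0} (<)" by (simp add: wfp_on_image)
qed

private lemma slice_tag_times: "slice m (tag S * G) = S * slice (m + 1) G"
proof (rule hahn_eqI)
  fix a
  let ?F = "{b. hcoeff S b \<noteq> 0 \<and> hcoeff (slice (m + 1) G) (a - b) \<noteq> 0}"
  have "hcoeff (tag S * G) (a, m)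
      = (\<Sum>p\<in>(\<lambda>b. (b, - 1)) ` ?F. hcoeff (tag S) p * hcoeff G ((a, m) - p))"
  proof (rule hcoeff_times_superset)
    show "finite ((\<lambda>b. (b, - 1 :: int)) ` ?F)" by (rule finite_imageI) (rule finite_hahn_fibre)
    fix p assume p: "hcoeff (tag S) p \<noteq> 0" "hcoeff G ((a, m) - p) \<noteq> 0"
    obtain b l where bl: "p = (b, l)" by (cases p)
    show "p \<in> (\<lambda>b. (b, - 1)) ` ?F"
      using p by (auto simp: bl tag.rep_eq slice.rep_eq split: if_splits)
  qed
  also have "\<dots> = (\<Sum>b\<in>?F. hcoeff S b * hcoeff (slice (m + 1) G) (a - b))"
    by (subst sum.reindex) (auto simp: inj_on_def tag.rep_eq slice.rep_eq)
  finally show "hcoeff (slice m (tag S * G)) a = hcoeff (S * slice (m + 1) G) a"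
    by (simp add: slice.rep_eq times_hahn.rep_eq)
qed

private lemma hahn_powers:
  fixes S :: "'a::linordered_ab_group_add hahn"
  assumes S: "hord S > Fin 0"
  obtains G :: "('a \<times> int) hahn"
  where "\<And>n. slice (- int n) G = S ^ n"
proof -
  have tag_pos: "0 < p" if p: "p \<in> hsupp (tag S)" for p
  proof -
    obtain a m where "p = (a, m)" by (cases p)
    then show ?thesis using p hord_pos_hsupp[OF S, of a]
      by (auto simp: hsupp_def tag.rep_eq zero_prod_def split: if_splits)
  qed
  have "\<exists>G. (1 - tag S) * G = 1"
  proof (rule hahn_unit_inverse_exists)
    have "hcoeff (tag S) 0 = 0" using tag_pos[of 0] by (auto simp: hsupp_def)
    then show "hcoeff (1 - tag S) 0 = 1" by (simp add: hcoeff_one)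
    fix p assume "p \<in> hsupp (1 - tag S)"
    then show "0 \<le> p" using tag_pos[of p]
      by (cases "p = 0") (auto simp: hsupp_def hcoeff_one less_imp_le)
  qed
  then obtain G where "(1 - tag S) * G = 1" ..
  then have "G = 1 + tag S * G" by (simp add: left_diff_distrib diff_eq_eq)
  moreover have "slice m (F + H) = slice m F + slice m H" for m F H
    by (rule hahn_eqI) (simp add: slice.rep_eq)
  ultimately have rec: "slice m G = slice m 1 + S * slice (m + 1) G" for m
    by (metis slice_tag_times)
  have one: "slice m 1 = (if m = 0 then 1 else 0)" for m
    by (rule hahn_eqI) (simp add: slice.rep_eq hcoeff_one zero_prod_def)
  have pos: "slice m G = 0" if "m > 0" for m
  proof (rule ccontr)
    assume "slice m G \<noteq> 0"
    then obtain a where "a \<in> hsupp (slice m G)" using hsupp_eq_empty_iff by blast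
    then have "{p \<in> hsupp G. snd p > 0} \<noteq> {}"
      using that by (auto simp: hsupp_def slice.rep_eq intro!: exI[of _ a] exI[of _ m])
    then obtain p where p: "p \<in> {p \<in> hsupp G. snd p > 0}"
      "\<And>q. q \<in> {p \<in> hsupp G. snd p > 0} \<Longrightarrow> p \<le> q"
      using wfp_on_less_minimum[OF wfp_on_hsupp[of G], of "{p \<in> hsupp G. snd p > 0}"] by blast
    obtain b l where bl: "p = (b, l)" by (cases p)
    have l: "l > 0" and "hcoeff (slice l G) b \<noteq> 0"
      using p(1) by (auto simp: bl hsupp_def slice.rep_eq)
    then have "hcoeff (S * slice (l + 1) G) b \<noteq> 0" using rec[of l] by (simp add: one)
    then obtain c where c: "hcoeff S c \<noteq> 0" "hcoeff (slice (l + 1) G) (b - c) \<noteq> 0"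
      unfolding times_hahn.rep_eq by (auto elim: sum.not_neutral_contains_not_neutral)
    then have "p \<le> (b - c, l + 1)" using l by (intro p(2)) (simp add: hsupp_def slice.rep_eq)
    moreover have "0 < c" using hord_pos_hsupp[OF S, of c] c(1) by (simp add: hsupp_def)
    ultimately show False by (auto simp: bl)
  qed
  have "slice (- int n) G = S ^ n" for n
  proof (induction n)
    case 0
    then show ?case using rec[of 0] pos[of 1] by (simp add: one)
  next
    case (Suc n)
    then show ?case using rec[of "- int (Suc n)"] by (simp add: one)
  qed
  then show thesis by (rule that)
qed

lemma finite_powers_hcoeff:
  fixes S :: "'a::linordered_ab_group_add hahn"
  assumes "hord S > Fin 0"
  shows "finite {n. hcoeff (S ^ n) a \<noteq> 0}"
proof (rule ccontr)
  assume inf: "infinite {n. hcoeff (S ^ n) a \<noteq> 0}"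
  obtain G :: "('a \<times> int) hahn" where G: "\<And>n. slice (- int n) G = S ^ n"
    using hahn_powers[OF assms] by blast
  let ?B = "(\<lambda>n. (a, - int n)) ` {n. hcoeff (S ^ n) a \<noteq> 0}"
  have "?B \<subseteq> hsupp G" by (auto simp: hsupp_def G[symmetric] slice.rep_eq)
  moreover have "?B \<noteq> {}" using infinite_imp_nonempty[OF inf] by blast
  ultimately obtain p where p: "p \<in> ?B" "\<And>q. q \<in> ?B \<Longrightarrow> p \<le> q"
    by (rule wfp_on_less_minimum[OF wfp_on_hsupp]) (rule that)
  then obtain n where n: "p = (a, - int n)" by blast
  have "{n. hcoeff (S ^ n) a \<noteq> 0} \<subseteq> {..n}"
  proof
    fix j assume "j \<in> {n. hcoeff (S ^ n) a \<noteq> 0}"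
    then have "p \<le> (a, - int j)" using p(2) by blast
    then show "j \<in> {..n}" by (simp add: n)
  qed
  then show False using inf finite_subset by blast
qed

lemma wfp_on_powers_hsupp:
  fixes S :: "'a::linordered_ab_group_add hahn"
  assumes "hord S > Fin 0"
  shows "wfp_on (\<Union>n. hsupp (S ^ n)) (<)"
  unfolding wfp_on_iff_ex_minimal
proof (intro allI impI)
  fix B assume B: "B \<subseteq> (\<Union>n. hsupp (S ^ n))" "B \<noteq> {}"
  obtain G :: "('a \<times> int) hahn" where G: "\<And>n. slice (- int n) G = S ^ n"
    using hahn_powers[OF assms] by blast
  have in_G: "\<exists>m. (b, m) \<in> hsupp G" if b: "b \<in> B" for b
  proof -
    obtain n where "hcoeff (slice (- int n) G) b \<noteq> 0"
      using b B(1) unfolding G hsupp_def by blast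
    then show ?thesis by (auto simp: hsupp_def slice.rep_eq)
  qed
  let ?P = "{p \<in> hsupp G. fst p \<in> B}"
  have "?P \<subseteq> hsupp G" "?P \<noteq> {}" using B(2) in_G by fastforce+
  then obtain p where p: "p \<in> ?P" "\<And>q. q \<in> ?P \<Longrightarrow> p \<le> q"
    by (rule wfp_on_less_minimum[OF wfp_on_hsupp]) (rule that)
  have "y \<notin> B" if "y < fst p" for y
  proof
    assume "y \<in> B"
    then obtain m where "(y, m) \<in> ?P" using in_G by auto
    then have "p \<le> (y, m)" by (rule p(2))
    then show False using that by (auto simp: less_eq_prod_def)
  qed
  then show "\<exists>z\<in>B. \<forall>y<z. y \<notin> B" using p(1) by (intro bexI[of _ "fst p"]) auto
qed

end

text \<open>The coefficientwise sum; by \<open>hcoeff_hahn_fps_eval\<close> it is a series whenever \<open>S\<close> has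
  positive order, and by \<open>finite_powers_hcoeff\<close> only finitely many summands contribute to each
  coefficient.\<close>

definition hahn_fps_eval :: "real fps \<Rightarrow> 'a::linordered_ab_group_add hahn \<Rightarrow> 'a hahn" where
  "hahn_fps_eval h S = Abs_hahn (\<lambda>a. suminf (\<lambda>i. fps_nth h i * hcoeff (S ^ i) a))"

lemma hcoeff_hahn_fps_eval:
  fixes S :: "'a::linordered_ab_group_add hahn"
  assumes "hord S > Fin 0"
  shows "hcoeff (hahn_fps_eval h S) a = suminf (\<lambda>i. fps_nth h i * hcoeff (S ^ i) a)"
proof -
  let ?f = "\<lambda>a. suminf (\<lambda>i. fps_nth h i * hcoeff (S ^ i) a)"
  have "{a. ?f a \<noteq> 0} \<subseteq> (\<Union>n. hsupp (S ^ n))"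
  proof
    fix a assume "a \<in> {a. ?f a \<noteq> 0}"
    then have "\<exists>i. hcoeff (S ^ i) a \<noteq> 0" by (rule contrapos_pp) simp
    then show "a \<in> (\<Union>n. hsupp (S ^ n))" by (auto simp: hsupp_def)
  qed
  then have "wfp_on {a. ?f a \<noteq> 0} (<)"
    by (rule wfp_on_subset[OF wfp_on_powers_hsupp[OF assms]])
  then show ?thesis by (simp add: hahn_fps_eval_def Abs_hahn_inverse)
qed

text \<open>The pair \<open>(\<alpha>, n)\<close> is the exponent vector of \<open>z\<^sup>\<alpha> \<ell>\<^sub>1\<^bsup>n 1\<^esup> \<ell>\<^sub>2\<^bsup>n 2\<^esup> \<dots>\<close>;
  index \<open>0\<close> of \<open>n\<close> is never used. On pairs and on finitely supported maps the library orders are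
  lexicographic, with smaller indices more significant. Depth \<open>k\<close> is imposed by \<open>Linf\<close> below, so
  that all depths share one type.\<close>

type_synonym log_exponent = "real \<times> (nat \<Rightarrow>\<^sub>0 int)"

type_synonym log_series = "log_exponent hahn"

definition Linf :: "nat \<Rightarrow> log_series set" where
  "Linf k = {f. \<forall>(\<alpha>, n) \<in> hsupp f. Poly_Mapping.keys n \<subseteq> {1..k}}"

definition L :: "nat \<Rightarrow> log_series set" where
  "L k = {f \<in> Linf k. hord f > Fin 0}"

definition B1 :: "nat \<Rightarrow> log_series set" where
  "B1 k = {f \<in> Linf k. \<forall>(\<alpha>, n) \<in> hsupp f. \<alpha> = 0}"

definition B_ge1_plus :: "nat \<Rightarrow> log_series set" where
  "B_ge1_plus k = {R \<in> B1 k. hord R > Fin 0}"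

lemma B_ge1_plus_subset_L: "B_ge1_plus k \<subseteq> L k"
  by (auto simp: B_ge1_plus_def B1_def L_def)

definition ell :: "nat \<Rightarrow> log_series" where
  "ell j = hmonom 1 (0, Poly_Mapping.single j 1)"

definition ones :: "nat \<Rightarrow> (nat \<Rightarrow>\<^sub>0 int)" where
  "ones j = (\<Sum>i = 1..j. Poly_Mapping.single i 1)"

lemma lookup_ones: "Poly_Mapping.lookup (ones j) i = (if 1 \<le> i \<and> i \<le> j then 1 else 0)"
  by (simp add: ones_def lookup_sum lookup_single when_def sum.delta)

text \<open>By the Leibniz rule \<open>D\<^sub>1\<close> sends the monomial with exponent vector \<open>n\<close> to
  \<open>\<Sum>j = 1..k. n\<^sub>j \<ell>\<^sub>1 \<dots> \<ell>\<^sub>j \<ell>\<^sup>n\<close> (lemmas \<open>D1_hmonom\<close> and \<open>D1_ell\<close>); the definition collects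
  the contributions to a given exponent vector. Powers of \<open>z\<close> are treated as constants,
  so this is \<open>z d/dz\<close> only on \<open>B1 k\<close>.\<close>

lift_definition D1 :: "nat \<Rightarrow> log_series \<Rightarrow> log_series" is
  "\<lambda>k f (\<alpha>, m). \<Sum>j = 1..k. real_of_int (Poly_Mapping.lookup (m - ones j) j) * f (\<alpha>, m - ones j)"
proof -
  fix k and f :: "log_exponent \<Rightarrow> real"
  assume f: "wfp_on {a. f a \<noteq> 0} (<)"
  let ?A = "\<lambda>j. {a + b | a b. a \<in> {a. f a \<noteq> 0} \<and> b \<in> {(0, ones j)}}"
  have "wfp_on (\<Union>j\<in>{1..k}. ?A j) (<)"
    by (intro wfp_on_less_UN_finite wfp_on_less_plus f wfp_on_less_finite) simp_all
  then show "wfp_on {a. (case a of (\<alpha>, m) \<Rightarrow>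
    \<Sum>j = 1..k. real_of_int (Poly_Mapping.lookup (m - ones j) j) * f (\<alpha>, m - ones j)) \<noteq> 0} (<)"
  proof (rule wfp_on_subset, intro subsetI)
    fix a assume "a \<in> {a. (case a of (\<alpha>, m) \<Rightarrow>
      \<Sum>j = 1..k. real_of_int (Poly_Mapping.lookup (m - ones j) j) * f (\<alpha>, m - ones j)) \<noteq> 0}"
    then obtain \<alpha> m where am: "a = (\<alpha>, m)"
      "(\<Sum>j = 1..k. real_of_int (Poly_Mapping.lookup (m - ones j) j) * f (\<alpha>, m - ones j)) \<noteq> 0"
      by (cases a) simp
    from am(2) obtain j where "j \<in> {1..k}" "f (\<alpha>, m - ones j) \<noteq> 0"
      by (rule sum.not_neutral_contains_not_neutral) simp
    then show "a \<in> (\<Union>j\<in>{1..k}. ?A j)"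
      using am(1) plus_set_memI[of "(\<alpha>, m - ones j)" "{a. f a \<noteq> 0}" a "{(0, ones j)}"]
      by (intro UN_I[of j]) simp_all
  qed
qed

lemma hcoeff_sum: "hcoeff (sum F I) a = (\<Sum>i\<in>I. hcoeff (F i) a)"
  by (induction I rule: infinite_finite_induct) simp_all

lemma D1_hmonom:
  "D1 k (hmonom c (\<alpha>, n)) = (\<Sum>j = 1..k. hmonom (c * real_of_int (Poly_Mapping.lookup n j)) (\<alpha>, n + ones j))"
  by (rule hahn_eqI)
    (auto simp: D1.rep_eq hcoeff_sum hmonom.rep_eq diff_eq_eq split: prod.splits intro!: sum.cong)

lemma prod_ell: "(\<Prod>i = 1..j. ell i) = hmonom 1 (0, ones j)"
proof (induction j)
  case 0
  then show ?case by (simp add: ones_def one_hahn_def zero_prod_def)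
next
  case (Suc j)
  then show ?case by (simp add: ell_def hmonom_times_hmonom ones_def add.commute)
qed

lemma D1_ell:
  assumes "j \<in> {1..k}"
  shows "D1 k (ell j) = (\<Prod>i = 1..<j. ell i) * ell j ^ 2"
proof -
  have "D1 k (ell j) = (\<Sum>i = 1..k. if i = j then hmonom 1 (0, Poly_Mapping.single j 1 + ones j) else 0)"
    unfolding ell_def D1_hmonom
    by (intro sum.cong refl) (auto simp: lookup_single when_def intro!: hahn_eqI simp: hmonom.rep_eq)
  also have "\<dots> = ell j * (\<Prod>i = 1..j. ell i)"
    using assms unfolding prod_ell by (simp add: ell_def hmonom_times_hmonom)
  also have "(\<Prod>i = 1..j. ell i) = (\<Prod>i = 1..<j. ell i) * ell j"
    using assms by (subst prod.last_plus) (auto simp: atLeastLessThanSuc_atLeastAtMost mult.commute)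
  finally show ?thesis by (simp add: power2_eq_square ac_simps)
qed

end

theory Submission
  imports Defs
begin

text \<open>Put \<open>S = N Q\<close>. By the Leibniz rule the equation becomes
  \<open>N D\<^sub>1(Q) = K N Q - T h(N Q) + M\<close> with \<open>ord Q > 0\<close>. On a series of order \<open>p > 0\<close> the
  derivation multiplies the leading term by \<open>p\<^sub>j \<ell>\<^sub>1 \<dots> \<ell>\<^sub>j\<close>, where \<open>j\<close> is the first index with
  \<open>p\<^sub>j \<noteq> 0\<close>. The induced map on orders is a strictly increasing bijection onto the exponent
  vectors above \<open>(0, \<one>\<^sub>k)\<close>, and it increases an order by at most \<open>(0, \<one>\<^sub>k)\<close>. Apart from the
  common factor \<open>N\<close>, the terms on the right raise the order of a difference by more than
  \<open>(0, \<one>\<^sub>k)\<close>, the nonlinear one because \<open>ord (D\<^sub>1(N)/N) + ord N\<close> exceeds \<open>(0, \<one>\<^sub>k)\<close>. So the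
  equation is triangular with nonzero diagonal, and it determines \<open>Q\<close> exponent by exponent.\<close>

section \<open>Orders of Hahn series\<close>

lemma Fin_le_hord_iff: "Fin a \<le> hord f \<longleftrightarrow> (\<forall>b\<in>hsupp f. a \<le> b)"
proof (cases "f = 0")
  case True
  then show ?thesis using hsupp_eq_empty_iff[of f] by (simp add: hord_def)
next
  case False
  then obtain m where "m \<in> hsupp f" "\<And>b. b \<in> hsupp f \<Longrightarrow> m \<le> b" "hord f = Fin m"
    using hsupp_least by blast
  then show ?thesis by (auto intro: order_trans)
qed

lemma Fin_less_hord_iff: "Fin a < hord f \<longleftrightarrow> (\<forall>b\<in>hsupp f. a < b)"
proof (cases "f = 0")
  case True
  then show ?thesis using hsupp_eq_empty_iff[of f] by (simp add: hord_def)
next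
  case False
  then obtain m where "m \<in> hsupp f" "\<And>b. b \<in> hsupp f \<Longrightarrow> m \<le> b" "hord f = Fin m"
    using hsupp_least by blast
  then show ?thesis by (auto intro: less_le_trans)
qed

lemma hcoeff_eq_0_below: "Fin a \<le> hord f \<Longrightarrow> b < a \<Longrightarrow> hcoeff f b = 0"
  by (force simp: Fin_le_hord_iff hsupp_def)

lemma hcoeff_eq_0_upto: "Fin a < hord f \<Longrightarrow> b \<le> a \<Longrightarrow> hcoeff f b = 0"
  by (force simp: Fin_less_hord_iff hsupp_def)

lemma Fin_le_hordI: "(\<And>b. b < a \<Longrightarrow> hcoeff f b = 0) \<Longrightarrow> Fin a \<le> hord f"
  by (force simp: Fin_le_hord_iff hsupp_def)

lemma Fin_less_hordI: "(\<And>b. b \<le> a \<Longrightarrow> hcoeff f b = 0) \<Longrightarrow> Fin a < hord f"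
  unfolding Fin_less_hord_iff hsupp_def using not_le by blast

lemma Fin_le_hord_add: "Fin a \<le> hord f \<Longrightarrow> Fin a \<le> hord g \<Longrightarrow> Fin a \<le> hord (f + g)"
  by (intro Fin_le_hordI) (simp add: hcoeff_eq_0_below)

lemma Fin_less_hord_add: "Fin a < hord f \<Longrightarrow> Fin a < hord g \<Longrightarrow> Fin a < hord (f + g)"
  by (intro Fin_less_hordI) (simp add: hcoeff_eq_0_upto)

lemma Fin_less_hord_diff: "Fin a < hord f \<Longrightarrow> Fin a < hord g \<Longrightarrow> Fin a < hord (f - g)"
  by (intro Fin_less_hordI) (simp add: hcoeff_eq_0_upto)

lemma hsupp_timesE:
  fixes f g :: "'a::linordered_ab_group_add hahn"
  assumes "c \<in> hsupp (f * g)"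
  obtains a b where "a \<in> hsupp f" "b \<in> hsupp g" "c = a + b"
proof -
  from assms obtain a where "hcoeff f a \<noteq> 0" "hcoeff g (c - a) \<noteq> 0"
    unfolding hsupp_def times_hahn.rep_eq by (auto elim: sum.not_neutral_contains_not_neutral)
  then show thesis using that[of a "c - a"] by (simp add: hsupp_def)
qed

lemma Fin_le_hord_times:
  fixes f g :: "'a::linordered_ab_group_add hahn"
  shows "Fin a \<le> hord f \<Longrightarrow> Fin b \<le> hord g \<Longrightarrow> Fin (a + b) \<le> hord (f * g)"
  unfolding Fin_le_hord_iff by (blast elim: hsupp_timesE intro: add_mono)

lemma Fin_less_hord_times_left:
  fixes f g :: "'a::linordered_ab_group_add hahn"
  shows "Fin a < hord f \<Longrightarrow> Fin b \<le> hord g \<Longrightarrow> Fin (a + b) < hord (f * g)"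
  unfolding Fin_le_hord_iff Fin_less_hord_iff by (blast elim: hsupp_timesE intro: add_less_le_mono)

lemma Fin_less_hord_times_right:
  fixes f g :: "'a::linordered_ab_group_add hahn"
  shows "Fin a \<le> hord f \<Longrightarrow> Fin b < hord g \<Longrightarrow> Fin (a + b) < hord (f * g)"
  unfolding Fin_le_hord_iff Fin_less_hord_iff by (blast elim: hsupp_timesE intro: add_le_less_mono)

text \<open>The bounds \<open>a \<le> c\<close> and \<open>b \<le> a + b - c\<close> leave only
  \<open>c = a\<close>, so the convolution sum has a single term.\<close>

lemma hcoeff_times_least:
  fixes f g :: "'a::linordered_ab_group_add hahn"
  assumes f: "Fin a \<le> hord f" and g: "Fin b \<le> hord g"
  shows "hcoeff (f * g) (a + b) = hcoeff f a * hcoeff g b"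
proof -
  have "hcoeff (f * g) (a + b) = (\<Sum>c\<in>{a}. hcoeff f c * hcoeff g (a + b - c))"
  proof (rule hcoeff_times_superset)
    fix c assume c: "hcoeff f c \<noteq> 0" "hcoeff g (a + b - c) \<noteq> 0"
    then have "a \<le> c" "b \<le> a + b - c" using f g by (auto simp: Fin_le_hord_iff hsupp_def)
    then show "c \<in> {a}" by (simp add: le_diff_eq add.commute)
  qed simp
  then show ?thesis by simp
qed

text \<open>The two leading coefficients are nonzero reals, so their product does not
  vanish.\<close>

lemma add_in_hsupp_times:
  fixes f g :: "'a::linordered_ab_group_add hahn"
  assumes "hord f = Fin a" "hord g = Fin b"
  shows "a + b \<in> hsupp (f * g)"
proof -
  have "a \<in> hsupp f" "b \<in> hsupp g"
    using assms by (metis extended.distinct(1) extended.inject(1) hord_def hsupp_eq_empty_iff hsupp_least)+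
  then show ?thesis using hcoeff_times_least[of a f b g] assms by (simp add: hsupp_def)
qed

text \<open>This bounds the order of a quotient through its product with the denominator: a leading
  exponent \<open>c\<close> of \<open>g\<close> puts \<open>a + c\<close> into the support of
  \<open>f * g\<close>.\<close>

lemma Fin_le_hord_cancel:
  fixes f g :: "'a::linordered_ab_group_add hahn"
  assumes f: "hord f = Fin a" and fg: "Fin (a + b) \<le> hord (f * g)"
  shows "Fin b \<le> hord g"
proof (cases "g = 0")
  case False
  then obtain c where "hord g = Fin c" using hsupp_least by blast
  then show ?thesis using add_in_hsupp_times[OF f, of g c] fg by (auto simp: Fin_le_hord_iff)
qed (auto simp: Fin_le_hord_iff hsupp_def)

lemma Fin_less_hord_cancel:
  fixes f g :: "'a::linordered_ab_group_add hahn"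
  assumes f: "hord f = Fin a" and fg: "Fin (a + b) < hord (f * g)"
  shows "Fin b < hord g"
proof (cases "g = 0")
  case False
  then obtain c where "hord g = Fin c" using hsupp_least by blast
  then show ?thesis using add_in_hsupp_times[OF f, of g c] fg by (auto simp: Fin_less_hord_iff)
qed (auto simp: Fin_less_hord_iff hsupp_def)

section \<open>Powers and power series at series of positive order\<close>

lemma Fin_less_hord_power:
  fixes S :: "'a::linordered_ab_group_add hahn"
  assumes "Fin a < hord S" "0 \<le> a"
  shows "Fin a < hord (S ^ Suc n)"
proof (induction n)
  case (Suc n)
  have "Fin (a + a) < hord (S * S ^ Suc n)"
    using assms Suc by (intro Fin_less_hord_times_left) simp_all
  moreover have "Fin a \<le> Fin (a + a)" using assms(2) by simp
  ultimately show ?case by (metis le_less_trans power_Suc)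
qed (use assms in simp)

text \<open>Telescoping: \<open>S ^ (n + 2) - R ^ (n + 2) = S * (S ^ (n + 1) - R ^ (n + 1)) + (S -
  R) * R ^ (n + 1)\<close>, and factors of positive order do not lower orders.\<close>

lemma Fin_le_hord_power_diff:
  fixes S R :: "'a::linordered_ab_group_add hahn"
  assumes S: "Fin a < hord S" and R: "Fin a < hord R" and a: "0 \<le> a" and d: "Fin b \<le> hord (S - R)"
  shows "Fin b \<le> hord (S ^ Suc n - R ^ Suc n)"
proof (induction n)
  case (Suc n)
  have "Fin (0 + b) \<le> hord (S * (S ^ Suc n - R ^ Suc n))"
    using S a Suc by (intro Fin_le_hord_times) (auto simp: Fin_le_hord_iff Fin_less_hord_iff)
  moreover have "Fin (b + 0) \<le> hord ((S - R) * R ^ Suc n)"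
    using Fin_less_hord_power[OF R a, of n] a d
    by (intro Fin_le_hord_times) (force simp: Fin_le_hord_iff Fin_less_hord_iff)+
  ultimately have "Fin b \<le> hord (S * (S ^ Suc n - R ^ Suc n) + (S - R) * R ^ Suc n)"
    by (intro Fin_le_hord_add) simp_all
  then show ?case by (simp add: algebra_simps)
qed (use d in simp)

text \<open>From the square on, each summand of the telescoping identity has, besides a difference,
  a factor of order above \<open>a\<close>. This gain makes the nonlinear term of the equation
  contractive.\<close>

lemma Fin_less_hord_power_diff:
  fixes S R :: "'a::linordered_ab_group_add hahn"
  assumes S: "Fin a < hord S" and R: "Fin a < hord R" and a: "0 \<le> a" and d: "Fin b \<le> hord (S - R)"
  shows "Fin (a + b) < hord (S ^ Suc (Suc n) - R ^ Suc (Suc n))"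
proof -
  have "Fin (a + b) < hord (S * (S ^ Suc n - R ^ Suc n))"
    using S Fin_le_hord_power_diff[OF assms] by (rule Fin_less_hord_times_left)
  moreover have "Fin (b + a) < hord ((S - R) * R ^ Suc n)"
    using d Fin_less_hord_power[OF R a] by (rule Fin_less_hord_times_right)
  ultimately have "Fin (a + b) < hord (S * (S ^ Suc n - R ^ Suc n) + (S - R) * R ^ Suc n)"
    by (intro Fin_less_hord_add) (simp_all add: add.commute)
  then show ?thesis by (simp add: algebra_simps)
qed

lemma X_power2_dvd_fps_nth:
  fixes h :: "'a::comm_ring_1 fps"
  assumes "fps_X ^ 2 dvd h" "i < 2"
  shows "fps_nth h i = 0"
proof -
  obtain g where "h = fps_X ^ 2 * g" using assms(1) by (elim dvdE)
  then show ?thesis using assms(2) by (simp add: fps_X_power_mult_nth)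
qed

lemma hsupp_hahn_fps_eval:
  fixes S :: "'a::linordered_ab_group_add hahn"
  assumes "hord S > Fin 0"
  shows "hsupp (hahn_fps_eval h S) \<subseteq> (\<Union>i\<in>{i. fps_nth h i \<noteq> 0}. hsupp (S ^ i))"
proof
  fix a assume "a \<in> hsupp (hahn_fps_eval h S)"
  then have "suminf (\<lambda>i. fps_nth h i * hcoeff (S ^ i) a) \<noteq> 0"
    by (simp add: hsupp_def hcoeff_hahn_fps_eval[OF assms])
  then have "\<exists>i. fps_nth h i * hcoeff (S ^ i) a \<noteq> 0" by (rule contrapos_pp) (simp del: mult_eq_0_iff)
  then show "a \<in> (\<Union>i\<in>{i. fps_nth h i \<noteq> 0}. hsupp (S ^ i))" by (auto simp: hsupp_def)
qed

text \<open>Only powers from the square on occur in \<open>h\<close>, and each of them has order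
  above \<open>a + a\<close>.\<close>

lemma Fin_less_hord_hahn_fps_eval:
  fixes S :: "'a::linordered_ab_group_add hahn"
  assumes S: "Fin a < hord S" and a: "0 \<le> a" and h: "fps_X ^ 2 dvd h"
  shows "Fin (a + a) < hord (hahn_fps_eval h S)"
  unfolding Fin_less_hord_iff
proof
  have pos: "Fin 0 < hord S" using a by (intro le_less_trans[OF _ S]) simp
  fix b assume "b \<in> hsupp (hahn_fps_eval h S)"
  then obtain i where i: "fps_nth h i \<noteq> 0" "b \<in> hsupp (S ^ i)"
    using hsupp_hahn_fps_eval[OF pos] by blast
  then have "\<not> i < 2" using X_power2_dvd_fps_nth[OF h] by blast
  then obtain n where n: "i = Suc (Suc n)" by (metis One_nat_def Suc_1 less_2_cases_iff not0_implies_Suc)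
  have "Fin (a + a) < hord (S * S ^ Suc n)"
    using S less_imp_le[OF Fin_less_hord_power[OF S a]] by (rule Fin_less_hord_times_left)
  then show "a + a < b" using i(2) by (simp add: n Fin_less_hord_iff)
qed

lemma Fin_less_hord_hahn_fps_eval_diff:
  fixes S R :: "'a::linordered_ab_group_add hahn"
  assumes S: "Fin a < hord S" and R: "Fin a < hord R" and a: "0 \<le> a"
    and d: "Fin b \<le> hord (S - R)" and h: "fps_X ^ 2 dvd h"
  shows "Fin (a + b) < hord (hahn_fps_eval h S - hahn_fps_eval h R)"
proof (rule Fin_less_hordI)
  have pos: "Fin 0 < hord S" "Fin 0 < hord R"
    using a by (auto intro: le_less_trans[OF _ S] le_less_trans[OF _ R])
  fix c assume c: "c \<le> a + b"
  \<comment> \<open>The summands agree one by one, so the two infinite sums coincide without a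
    convergence argument.\<close>
  have "fps_nth h i * hcoeff (S ^ i) c = fps_nth h i * hcoeff (R ^ i) c" for i
  proof (cases "i < 2")
    case False
    then obtain n where n: "i = Suc (Suc n)" by (metis One_nat_def Suc_1 less_2_cases_iff not0_implies_Suc)
    show ?thesis
      using hcoeff_eq_0_upto[OF Fin_less_hord_power_diff[OF S R a d] c, of n] by (simp only: n minus_hahn.rep_eq) simp
  qed (simp add: X_power2_dvd_fps_nth[OF h])
  then have "(\<lambda>i. fps_nth h i * hcoeff (S ^ i) c) = (\<lambda>i. fps_nth h i * hcoeff (R ^ i) c)" by blast
  then show "hcoeff (hahn_fps_eval h S - hahn_fps_eval h R) c = 0"
    by (simp only: minus_hahn.rep_eq hcoeff_hahn_fps_eval[OF pos(1)] hcoeff_hahn_fps_eval[OF pos(2)] diff_self)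
qed

section \<open>Triangular equations over Hahn series\<close>

text \<open>Spherical completeness: solutions up to an exponent in their support agree wherever both are
  defined, so they glue to a maximal one, and a residual of the latter could be cancelled by one
  more monomial.\<close>

lemma hahn_triangular_zero_exists:
  fixes \<Phi> :: "'a::linorder hahn \<Rightarrow> 'b::linorder hahn" and \<phi> :: "'a \<Rightarrow> 'b"
  assumes mono: "strict_mono_on X \<phi>"
    and range: "\<And>f. hsupp f \<subseteq> X \<Longrightarrow> hsupp (\<Phi> f) \<subseteq> \<phi> ` X"
    and lead: "\<And>f g t. hsupp f \<subseteq> X \<Longrightarrow> hsupp g \<subseteq> X \<Longrightarrow> t \<in> X \<Longrightarrow>
      (\<And>s. s < t \<Longrightarrow> hcoeff f s = hcoeff g s) \<Longrightarrow>
      hcoeff (\<Phi> f) (\<phi> t) - hcoeff (\<Phi> g) (\<phi> t) = c t * (hcoeff f t - hcoeff g t)"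
    and c: "\<And>t. t \<in> X \<Longrightarrow> c t \<noteq> 0"
  shows "\<exists>f. hsupp f \<subseteq> X \<and> \<Phi> f = 0"
proof (rule ccontr)
  assume no_zero: "\<nexists>f. hsupp f \<subseteq> X \<and> \<Phi> f = 0"
  define good where
    "good g \<longleftrightarrow> hsupp g \<subseteq> X \<and> (\<forall>s\<in>hsupp g. \<forall>t\<in>X. t \<le> s \<longrightarrow> hcoeff (\<Phi> g) (\<phi> t) = 0)" for g
  have agree: "hcoeff g t = hcoeff g' t"
    if g: "good g" "s \<in> hsupp g" "t \<le> s" and g': "good g'" "s' \<in> hsupp g'" "t \<le> s'" for g g' s s' t
  proof (rule ccontr)
    assume "hcoeff g t \<noteq> hcoeff g' t"
    then have t: "t \<in> hsupp (g - g')" by (simp add: hsupp_def)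
    then have "g - g' \<noteq> 0" using hsupp_eq_empty_iff[of "g - g'"] by blast
    then obtain r where r: "r \<in> hsupp (g - g')" "\<And>b. b \<in> hsupp (g - g') \<Longrightarrow> r \<le> b"
      using hsupp_least by blast
    have "hsupp (g - g') \<subseteq> hsupp g \<union> hsupp g'" by (auto simp: hsupp_def)
    then have rX: "r \<in> X" using r(1) g(1) g'(1) by (auto simp: good_def)
    \<comment> \<open>At the first exponent of disagreement the residuals differ by a nonzero
      multiple of a nonzero number, although both vanish there.\<close>
    have "hcoeff (\<Phi> g) (\<phi> r) - hcoeff (\<Phi> g') (\<phi> r) = c r * (hcoeff g r - hcoeff g' r)"
    proof (rule lead)
      fix s assume "s < r"
      then have "s \<notin> hsupp (g - g')" using r(2)[of s] by auto
      then show "hcoeff g s = hcoeff g' s" by (simp add: hsupp_def)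
    qed (use g g' rX in \<open>auto simp: good_def\<close>)
    moreover have "hcoeff (\<Phi> g) (\<phi> r) = 0" "hcoeff (\<Phi> g') (\<phi> r) = 0"
      using g g' r(2)[OF t] rX unfolding good_def by (meson order_trans)+
    ultimately show False using r(1) c[OF rX] by (simp add: hsupp_def)
  qed
  define below where "below t g \<longleftrightarrow> good g \<and> (\<exists>s\<in>hsupp g. t \<le> s)" for t g
  \<comment> \<open>By \<open>agree\<close> the choice of the partial solution is immaterial; 0 is
    the default at exponents that none of them reaches.\<close>
  define U where "U t = (if \<exists>g. below t g then hcoeff (SOME g. below t g) t else 0)" for t
  have U: "U t = hcoeff g t" if "below t g" for t g
  proof -
    have "below t (SOME g. below t g)" using that by (rule someI)
    then have "hcoeff (SOME g. below t g) t = hcoeff g t"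
      using that agree unfolding below_def by blast
    then show ?thesis using that by (auto simp: U_def)
  qed
  have U_below: "\<exists>g. below t g" if "U t \<noteq> 0" for t
    using that by (auto simp: U_def split: if_splits)
  have below_mono: "below t g \<Longrightarrow> s \<le> t \<Longrightarrow> below s g" for s t g
    unfolding below_def by (meson order_trans)
  \<comment> \<open>A descending sequence stays below its first term, so it lies in the well-ordered
    support of one partial solution.\<close>
  have "wfp_on {a. U a \<noteq> 0} (<)"
    unfolding wfp_on_less_iff_no_descent
  proof
    assume "\<exists>s::nat \<Rightarrow> 'a. \<forall>n. s n \<in> {a. U a \<noteq> 0} \<and> s (Suc n) < s n"
    then obtain s :: "nat \<Rightarrow> 'a" where s: "\<And>n. U (s n) \<noteq> 0" "\<And>n. s (Suc n) < s n" by blast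
    obtain g where g: "below (s 0) g" using U_below[OF s(1)] by blast
    have "s n \<le> s 0" for n
      using lift_Suc_antimono_le[of s 0 n] s(2) by (simp add: less_imp_le)
    then have "s n \<in> hsupp g" for n
      using s(1)[of n] U[OF below_mono[OF g]] by (simp add: hsupp_def)
    then show False
      using s(2) wfp_on_hsupp[of g] unfolding wfp_on_less_iff_no_descent by blast
  qed
  then have cu: "hcoeff (Abs_hahn U) t = U t" for t by (simp add: Abs_hahn_inverse)
  define u where "u = Abs_hahn U"
  have uX: "hsupp u \<subseteq> X"
  proof
    fix s assume s: "s \<in> hsupp u"
    then obtain g where g: "below s g" using U_below by (auto simp: hsupp_def u_def cu)
    then have "s \<in> hsupp g" using s by (simp add: hsupp_def u_def cu U)
    then show "s \<in> X" using g by (auto simp: below_def good_def)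
  qed
  have good_u: "good u"
    unfolding good_def
  proof (intro conjI ballI impI)
    fix s t assume s: "s \<in> hsupp u" and t: "t \<in> X" "t \<le> s"
    obtain g where g: "below s g" using s U_below by (auto simp: hsupp_def u_def cu)
    have eq: "hcoeff u x = hcoeff g x" if "x \<le> t" for x
      using U[OF below_mono[OF g]] that t(2) by (simp add: u_def cu)
    have "hcoeff (\<Phi> u) (\<phi> t) - hcoeff (\<Phi> g) (\<phi> t) = c t * (hcoeff u t - hcoeff g t)"
      using g uX t eq by (intro lead) (auto simp: below_def good_def)
    moreover have "hcoeff (\<Phi> g) (\<phi> t) = 0"
      using g t unfolding below_def good_def by (meson order_trans)
    ultimately show "hcoeff (\<Phi> u) (\<phi> t) = 0" using eq[of t] by simp
  qed (rule uX)
  have "\<Phi> u \<noteq> 0" using no_zero uX by blast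
  then obtain r' where r': "r' \<in> hsupp (\<Phi> u)" "\<And>b. b \<in> hsupp (\<Phi> u) \<Longrightarrow> r' \<le> b"
    using hsupp_least by blast
  then obtain r where r: "r \<in> X" "r' = \<phi> r" using range[OF uX] by blast
  \<comment> \<open>Adding the coefficient \<open>e\<close> at \<open>r\<close> changes the residual
    at \<open>\<phi> r\<close> by \<open>c r * e\<close>, which cancels it.\<close>
  define e where "e = - hcoeff (\<Phi> u) (\<phi> r) / c r"
  have e: "e \<noteq> 0" using r'(1) c[OF r(1)] by (simp add: e_def hsupp_def r(2))
  have above: "s < r" if "s \<in> hsupp u" for s
  proof (rule ccontr)
    assume "\<not> s < r"
    then have "hcoeff (\<Phi> u) (\<phi> r) = 0" using good_u that r(1) unfolding good_def by simp
    then show False using e by (simp add: e_def)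
  qed
  then have ur: "hcoeff u r = 0" by (auto simp: hsupp_def)
  define g where "g = u + hmonom e r"
  have gr: "hcoeff g s = (if s = r then e else hcoeff u s)" for s
    by (simp add: g_def hmonom.rep_eq ur)
  have gX: "hsupp g \<subseteq> X" and g_le: "s \<in> hsupp g \<Longrightarrow> s \<le> r" for s
    using uX r(1) above[of s] by (auto simp: hsupp_def gr split: if_splits)
  have "hcoeff (\<Phi> g) (\<phi> t) = 0" if t: "t \<in> X" "t \<le> r" for t
  proof -
    have *: "hcoeff (\<Phi> g) (\<phi> t) - hcoeff (\<Phi> u) (\<phi> t) = c t * (hcoeff g t - hcoeff u t)"
      using t by (intro lead gX uX) (auto simp: gr)
    show ?thesis
    proof (cases "t = r")
      case True
      then show ?thesis using * c[OF t(1)] ur by (simp add: gr e_def)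
    next
      case False
      \<comment> \<open>Exponents below \<open>r\<close> are mapped below the leading exponent
        \<open>r'\<close> of the residual of \<open>u\<close>, where that residual is already
        zero.\<close>
      then have "\<phi> t < r'" using t r mono by (simp add: strict_mono_on_def)
      then have "\<phi> t \<notin> hsupp (\<Phi> u)" using r'(2)[of "\<phi> t"] by auto
      then show ?thesis using * False by (simp add: gr hsupp_def)
    qed
  qed
  then have "good g" using gX g_le unfolding good_def by (meson order_trans)
  moreover have "r \<in> hsupp g" using e by (simp add: hsupp_def gr)
  ultimately have "below r g" unfolding below_def by blast
  \<comment> \<open>Since \<open>g\<close> reaches \<open>r\<close>, the glued series takes the
    value \<open>e\<close> there, yet \<open>r\<close> lies strictly above the support of
    \<open>u\<close>.\<close>
  then have "hcoeff u r = hcoeff g r" by (simp add: u_def cu U)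
  then show False using e ur by (simp add: gr)
qed

section \<open>The derivation on logarithmic series\<close>

lemma less_poly_mapping_iff:
  "p < q \<longleftrightarrow> (\<exists>i. Poly_Mapping.lookup p i < Poly_Mapping.lookup q i \<and>
     (\<forall>i'<i. Poly_Mapping.lookup p i' = Poly_Mapping.lookup q i'))"
  by transfer (simp add: less_fun_def)

lemma ones_less_iff: "ones i < ones j \<longleftrightarrow> i < j"
proof -
  have *: "ones i < ones j" if "i < j" for i j
    unfolding less_poly_mapping_iff using that by (intro exI[of _ "Suc i"]) (auto simp: lookup_ones)
  then show ?thesis by (metis less_asym less_irrefl linorder_neqE_nat)
qed

text \<open>The vectors \<open>ones i\<close> and \<open>ones j\<close> agree at all indices up to
  \<open>i\<close>, and a vector lexicographically between them shares this common initial
  part.\<close>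

lemma lookup_between_ones:
  assumes p: "ones i \<le> p" "p \<le> ones j" and i: "1 \<le> i" "i < j"
  shows "Poly_Mapping.lookup p i = 1"
proof (cases "p = ones j")
  case False
  then have "p < ones j" using p by simp
  then obtain l where l: "Poly_Mapping.lookup p l < Poly_Mapping.lookup (ones j) l"
    "\<And>l'. l' < l \<Longrightarrow> Poly_Mapping.lookup p l' = Poly_Mapping.lookup (ones j) l'"
    unfolding less_poly_mapping_iff by blast
  have "i < l"
  proof (rule ccontr)
    assume "\<not> i < l"
    then have "p < ones i"
      unfolding less_poly_mapping_iff using l i by (intro exI[of _ l]) (auto simp: lookup_ones)
    then show False using p(1) by simp
  qed
  then show ?thesis using l(2)[of i] i by (simp add: lookup_ones)
qed (use i in \<open>simp add: lookup_ones\<close>)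

text \<open>The exponents allowed in \<open>B1 k\<close>. They form a group, which reduces the
  closure properties of \<open>B1 k\<close> to sums and differences of exponents.\<close>

definition log_exponents :: "nat \<Rightarrow> log_exponent set" where
  "log_exponents k = {(\<alpha>, n). \<alpha> = 0 \<and> Poly_Mapping.keys n \<subseteq> {1..k}}"

lemma log_exponents_iff:
  "p \<in> log_exponents k \<longleftrightarrow> fst p = 0 \<and> (\<forall>i. i \<notin> {1..k} \<longrightarrow> Poly_Mapping.lookup (snd p) i = 0)"
  by (cases p) (auto simp: log_exponents_def in_keys_iff subset_eq)

lemma log_exponents_group:
  "0 \<in> log_exponents k"
  "p \<in> log_exponents k \<Longrightarrow> q \<in> log_exponents k \<Longrightarrow> p + q \<in> log_exponents k"
  "p \<in> log_exponents k \<Longrightarrow> q \<in> log_exponents k \<Longrightarrow> p - q \<in> log_exponents k"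
  by (auto simp: log_exponents_iff lookup_add lookup_minus)

lemma ones_in_log_exponents: "j \<le> k \<Longrightarrow> (0, ones j) \<in> log_exponents k"
  by (auto simp: log_exponents_iff lookup_ones)

definition lead_index :: "log_exponent \<Rightarrow> nat" where
  "lead_index p = (LEAST i. Poly_Mapping.lookup (snd p) i \<noteq> 0)"

text \<open>For \<open>p > 0\<close> this is the order of \<open>D1 k\<close> applied to the monomial with exponent \<open>p\<close>.\<close>

definition D1_order :: "log_exponent \<Rightarrow> log_exponent" where
  "D1_order p = p + (0, ones (lead_index p))"

lemma lead_index_eqI:
  assumes "Poly_Mapping.lookup (snd p) j \<noteq> 0" "\<And>i. i < j \<Longrightarrow> Poly_Mapping.lookup (snd p) i = 0"
  shows "lead_index p = j"
  unfolding lead_index_def using assms by (intro Least_equality) (auto simp: not_less[symmetric])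

text \<open>Lexicographic positivity with vanishing exponent of z means that the first nonzero entry
  is positive; the support condition places its index in \<open>{1..k}\<close>.\<close>

lemma lead_index:
  assumes p: "p \<in> log_exponents k" "0 < p"
  shows "1 \<le> lead_index p" "lead_index p \<le> k" "Poly_Mapping.lookup (snd p) (lead_index p) > 0"
    "\<And>i. i < lead_index p \<Longrightarrow> Poly_Mapping.lookup (snd p) i = 0"
proof -
  have "0 < snd p" using p by (cases p) (auto simp: log_exponents_def zero_prod_def)
  then obtain j where j: "Poly_Mapping.lookup (snd p) j > 0"
    "\<And>i. i < j \<Longrightarrow> Poly_Mapping.lookup (snd p) i = 0"
    unfolding less_poly_mapping_iff by auto
  then have "lead_index p = j" by (intro lead_index_eqI) auto
  moreover have "j \<in> {1..k}" using p j(1) by (auto simp: log_exponents_iff)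
  ultimately show "1 \<le> lead_index p" "lead_index p \<le> k" "Poly_Mapping.lookup (snd p) (lead_index p) > 0"
    "\<And>i. i < lead_index p \<Longrightarrow> Poly_Mapping.lookup (snd p) i = 0"
    using j by auto
qed

lemma less_log_exponentI:
  fixes p q :: log_exponent
  assumes "fst p = fst q" "Poly_Mapping.lookup (snd p) i < Poly_Mapping.lookup (snd q) i"
    "\<And>i'. i' < i \<Longrightarrow> Poly_Mapping.lookup (snd p) i' = Poly_Mapping.lookup (snd q) i'"
  shows "p < q"
proof -
  have "snd p < snd q" unfolding less_poly_mapping_iff using assms by blast
  then show ?thesis using assms(1) by (cases p; cases q) simp
qed

lemma strict_mono_on_D1_order: "strict_mono_on {p \<in> log_exponents k. 0 < p} D1_order"
proof (rule strict_mono_onI)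
  fix p q assume "p \<in> {p \<in> log_exponents k. 0 < p}" "q \<in> {p \<in> log_exponents k. 0 < p}" and pq: "p < q"
  then have p: "p \<in> log_exponents k" "0 < p" and q: "q \<in> log_exponents k" "0 < q" by auto
  note lp = lead_index[OF p] and lq = lead_index[OF q]
  have fst: "fst p = 0" "fst q = 0" using p q by (auto simp: log_exponents_iff)
  consider "lead_index p = lead_index q" | "lead_index p < lead_index q" | "lead_index q < lead_index p"
    by linarith
  then show "D1_order p < D1_order q"
  proof cases
    case 1
    then show ?thesis using pq by (simp add: D1_order_def)
  next
    case 2
    \<comment> \<open>Of two positive exponents the one with the later leading index is smaller, so
      this case contradicts \<open>p < q\<close>.\<close>
    have "q < p" by (rule less_log_exponentI[of _ _ "lead_index p"]) (use 2 lp lq fst in auto)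
    then show ?thesis using pq by simp
  next
    case 3
    \<comment> \<open>At the leading index of \<open>q\<close> the image of \<open>p\<close> has
      entry 1 and that of \<open>q\<close> at least 2; before it the images agree.\<close>
    show ?thesis unfolding D1_order_def
      by (rule less_log_exponentI[of _ _ "lead_index q"])
        (use 3 lp lq fst in \<open>auto simp: lookup_add lookup_ones\<close>)
  qed
qed

lemma D1_order_le:
  assumes "p \<in> log_exponents k" "0 < p"
  shows "D1_order p \<le> p + (0, ones k)"
  unfolding D1_order_def using lead_index(2)[OF assms] ones_less_iff[of "lead_index p" k]
  by (cases "lead_index p = k") (auto intro!: add_left_mono)

text \<open>Before the leading index the two vectors agree; at it the entry 1 is compared with 1
  plus the positive leading entry of \<open>p\<close>.\<close>

lemma D1_order_greater:
  assumes "p \<in> log_exponents k" "0 < p"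
  shows "(0, ones k) < D1_order p"
  unfolding D1_order_def
  by (rule less_log_exponentI[of _ _ "lead_index p"])
    (use lead_index[OF assms] assms in \<open>auto simp: log_exponents_iff lookup_add lookup_ones\<close>)

lemma in_image_D1_order:
  assumes m: "m \<in> log_exponents k" "(0, ones k) < m"
  shows "m \<in> D1_order ` {p \<in> log_exponents k. 0 < p}"
proof -
  have m0: "fst m = 0" using m by (auto simp: log_exponents_iff)
  then have "ones k < snd m" using m(2) by (cases m) simp
  then obtain j where j: "Poly_Mapping.lookup (ones k) j < Poly_Mapping.lookup (snd m) j"
    "\<And>i. i < j \<Longrightarrow> Poly_Mapping.lookup (ones k) i = Poly_Mapping.lookup (snd m) i"
    unfolding less_poly_mapping_iff by blast
  have jk: "j \<in> {1..k}"
  proof (rule ccontr)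
    assume "j \<notin> {1..k}"
    then show False using j(1) m(1) by (auto simp: log_exponents_iff lookup_ones split: if_splits)
  qed
  \<comment> \<open>Here \<open>j\<close> is the first index where \<open>m\<close> exceeds
    \<open>ones k\<close>, so removing \<open>ones j\<close> leaves zeros before \<open>j\<close>
    and a positive entry at \<open>j\<close>. Hence \<open>j\<close> is the leading index of
    \<open>p\<close>.\<close>
  define p where "p = m - (0, ones j)"
  have pj: "Poly_Mapping.lookup (snd p) j > 0"
    and pi: "\<And>i. i < j \<Longrightarrow> Poly_Mapping.lookup (snd p) i = 0"
    using j jk by (auto simp: p_def lookup_minus lookup_ones dest!: j(2)[symmetric])
  have "p \<in> log_exponents k"
    unfolding p_def using m jk by (intro log_exponents_group ones_in_log_exponents) auto
  moreover have "0 < p"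
    by (rule less_log_exponentI[of _ _ j]) (use pj pi m0 in \<open>auto simp: p_def\<close>)
  moreover have "lead_index p = j" using pj pi by (intro lead_index_eqI) auto
  ultimately show ?thesis
    by (intro image_eqI[of _ _ p]) (auto simp: D1_order_def p_def)
qed

section \<open>Leading coefficient of a derivative and the Leibniz rule\<close>

lemma hcoeff_D1:
  "hcoeff (D1 k f) m = (\<Sum>j = 1..k. real_of_int (Poly_Mapping.lookup (snd (m - (0, ones j))) j) *
     hcoeff f (m - (0, ones j)))"
  by (cases m) (simp add: D1.rep_eq)

text \<open>The summand with index \<open>j\<close> reads off the exponent \<open>n = m - (0, ones j)\<close>. If \<open>j\<close> is below
  the leading index of \<open>p\<close>, then \<open>p \<le> n\<close> and \<open>m \<le> D1_order p\<close> force \<open>n\<^sub>j = 0\<close>, so it vanishes.\<close>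

lemma hcoeff_D1_upto_order:
  assumes p: "p \<in> log_exponents k" "0 < p" and f: "Fin p \<le> hord f" and m: "m \<le> D1_order p"
  shows "hcoeff (D1 k f) m =
    (if m = D1_order p then real_of_int (Poly_Mapping.lookup (snd p) (lead_index p)) * hcoeff f p else 0)"
proof -
  note lp = lead_index[OF p]
  let ?l = "lead_index p"
  have "real_of_int (Poly_Mapping.lookup (snd (m - (0, ones j))) j) * hcoeff f (m - (0, ones j)) =
    (if j = ?l then if m = D1_order p then real_of_int (Poly_Mapping.lookup (snd p) ?l) * hcoeff f p else 0 else 0)"
    if j: "j \<in> {1..k}" for j
  proof (cases "m - (0, ones j) < p")
    case True
    then have "hcoeff f (m - (0, ones j)) = 0" by (rule hcoeff_eq_0_below[OF f])
    \<comment> \<open>For \<open>j = ?l\<close> and \<open>m = D1_order p\<close> the exponent read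
      off would be \<open>p\<close> itself.\<close>
    moreover have "j \<noteq> ?l" if "m = D1_order p" using True that by (auto simp: D1_order_def zero_prod_def[symmetric])
    ultimately show ?thesis by auto
  next
    case False
    then have le: "(0, ones j) \<le> m - p" by (simp add: not_less le_diff_eq add.commute)
    have le': "m - p \<le> (0, ones ?l)" using m by (simp add: D1_order_def diff_le_eq add.commute)
    obtain q where q: "m - p = (0, q)" "ones j \<le> q" "q \<le> ones ?l"
      using le le' by (cases "m - p") auto
    have "j \<le> ?l" using q(2,3) ones_less_iff[of ?l j] by (auto simp: not_less[symmetric])
    show ?thesis
    proof (cases "j = ?l")
      case True
      then have "m = D1_order p" using le le' by (simp add: D1_order_def diff_eq_eq add.commute)
      then show ?thesis using True by (simp add: D1_order_def)
    next
      case False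
      then have j: "j < ?l" using \<open>j \<le> ?l\<close> by simp
      have "Poly_Mapping.lookup q j = 1" using q j \<open>j \<in> {1..k}\<close> by (intro lookup_between_ones) auto
      moreover have "m = p + (0, q)" using q(1) by (simp add: diff_eq_eq add.commute)
      ultimately have "Poly_Mapping.lookup (snd (m - (0, ones j))) j = 0"
        using lp(4)[OF j] \<open>j \<in> {1..k}\<close> by (simp add: lookup_minus lookup_add lookup_ones)
      then show ?thesis using False by simp
    qed
  qed
  then have "hcoeff (D1 k f) m = (\<Sum>j = 1..k.
    if j = ?l then if m = D1_order p then real_of_int (Poly_Mapping.lookup (snd p) ?l) * hcoeff f p else 0 else 0)"
    unfolding hcoeff_D1 by (intro sum.cong) simp_all
  then show ?thesis using lp by (simp add: sum.delta)
qed

text \<open>The Euler derivation \<open>ell j * d / d (ell j)\<close>. Monomials are its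
  eigenvectors, and \<open>D1\<close> is a sum of these derivations with monomial factors, so its
  Leibniz rule can be proved without shifting exponents.\<close>

lift_definition lookup_deriv :: "nat \<Rightarrow> log_series \<Rightarrow> log_series" is
  "\<lambda>j f p. real_of_int (Poly_Mapping.lookup (snd p) j) * f p"
  by (erule wfp_on_subset) auto

lemma lookup_deriv_times: "lookup_deriv j (f * g) = lookup_deriv j f * g + f * lookup_deriv j g"
proof (rule hahn_eqI)
  fix c
  \<comment> \<open>One index set serves all three products, because \<open>lookup_deriv\<close>
    does not enlarge supports.\<close>
  let ?F = "{a. hcoeff f a \<noteq> 0 \<and> hcoeff g (c - a) \<noteq> 0}"
  have fin: "finite ?F" by (rule finite_hahn_fibre)
  have "hcoeff (f * g) c = (\<Sum>a\<in>?F. hcoeff f a * hcoeff g (c - a))"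
    by (simp add: times_hahn.rep_eq)
  moreover have "hcoeff (lookup_deriv j f * g) c = (\<Sum>a\<in>?F. hcoeff (lookup_deriv j f) a * hcoeff g (c - a))"
    using fin by (rule hcoeff_times_superset) (auto simp: lookup_deriv.rep_eq)
  moreover have "hcoeff (f * lookup_deriv j g) c = (\<Sum>a\<in>?F. hcoeff f a * hcoeff (lookup_deriv j g) (c - a))"
    using fin by (rule hcoeff_times_superset) (auto simp: lookup_deriv.rep_eq)
  ultimately show "hcoeff (lookup_deriv j (f * g)) c = hcoeff (lookup_deriv j f * g + f * lookup_deriv j g) c"
    by (simp add: lookup_deriv.rep_eq sum_distrib_left sum.distrib[symmetric] lookup_minus algebra_simps)
qed

lemma D1_eq_sum: "D1 k f = (\<Sum>j = 1..k. hmonom 1 (0, ones j) * lookup_deriv j f)"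
  by (rule hahn_eqI) (simp add: hcoeff_D1 hcoeff_sum hcoeff_hmonom_times lookup_deriv.rep_eq)

lemma D1_times: "D1 k (f * g) = D1 k f * g + f * D1 k g"
  unfolding D1_eq_sum lookup_deriv_times
  by (simp add: sum_distrib_left sum_distrib_right sum.distrib algebra_simps)

lemma D1_diff: "D1 k (f - g) = D1 k f - D1 k g"
  by (rule hahn_eqI) (simp add: hcoeff_D1 sum_subtractf right_diff_distrib)

section \<open>Closure properties of \<open>B1\<close>\<close>

lemma B1_iff: "f \<in> B1 k \<longleftrightarrow> hsupp f \<subseteq> log_exponents k"
  by (auto simp: B1_def Linf_def log_exponents_def)

lemma B1_diff: "f \<in> B1 k \<Longrightarrow> g \<in> B1 k \<Longrightarrow> f - g \<in> B1 k"
proof -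
  have "hsupp (f - g) \<subseteq> hsupp f \<union> hsupp g" by (auto simp: hsupp_def)
  then show "f \<in> B1 k \<Longrightarrow> g \<in> B1 k \<Longrightarrow> f - g \<in> B1 k" unfolding B1_iff by blast
qed

lemma B1_add: "f \<in> B1 k \<Longrightarrow> g \<in> B1 k \<Longrightarrow> f + g \<in> B1 k"
proof -
  have "hsupp (f + g) \<subseteq> hsupp f \<union> hsupp g" by (auto simp: hsupp_def)
  then show "f \<in> B1 k \<Longrightarrow> g \<in> B1 k \<Longrightarrow> f + g \<in> B1 k" unfolding B1_iff by blast
qed

lemma B1_times: "f \<in> B1 k \<Longrightarrow> g \<in> B1 k \<Longrightarrow> f * g \<in> B1 k"
  unfolding B1_iff by (blast elim: hsupp_timesE intro: log_exponents_group)

lemma B1_one: "1 \<in> B1 k"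
  using log_exponents_group(1) by (auto simp: B1_iff hsupp_def hcoeff_one split: if_splits)

lemma B1_power: "f \<in> B1 k \<Longrightarrow> f ^ n \<in> B1 k"
  by (induction n) (simp_all add: B1_one B1_times)

lemma B1_D1:
  assumes "f \<in> B1 k"
  shows "D1 k f \<in> B1 k"
  unfolding B1_iff
proof
  fix m assume "m \<in> hsupp (D1 k f)"
  then obtain j where j: "j \<in> {1..k}" "hcoeff f (m - (0, ones j)) \<noteq> 0"
    unfolding hsupp_def mem_Collect_eq hcoeff_D1 by (metis (no_types, lifting) mult_zero_right sum.neutral)
  then have "m - (0, ones j) \<in> log_exponents k" using assms by (auto simp: B1_iff hsupp_def)
  moreover have "(0, ones j) \<in> log_exponents k" using j by (intro ones_in_log_exponents) simp
  ultimately have "m - (0, ones j) + (0, ones j) \<in> log_exponents k" by (rule log_exponents_group)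
  then show "m \<in> log_exponents k" by (simp only: diff_add_cancel)
qed

lemma B1_hahn_fps_eval:
  assumes "S \<in> B1 k" "Fin 0 < hord S"
  shows "hahn_fps_eval h S \<in> B1 k"
  using hsupp_hahn_fps_eval[OF assms(2)] B1_power[OF assms(1)] unfolding B1_iff by blast

text \<open>The leading exponent \<open>p\<close> of \<open>f\<close> gives the lower bound
  \<open>D1_order p\<close>, which lies above \<open>(0, ones k)\<close>.\<close>

lemma Fin_less_hord_D1:
  assumes f: "f \<in> B1 k" "Fin 0 < hord f"
  shows "Fin (0, ones k) < hord (D1 k f)"
proof (cases "f = 0")
  case True
  then show ?thesis by (auto simp: Fin_less_hord_iff hsupp_def hcoeff_D1)
next
  case False
  then obtain p where p: "p \<in> hsupp f" "hord f = Fin p" using hsupp_least by blast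
  then have "p \<in> log_exponents k" "0 < p" using f by (auto simp: B1_iff)
  then have "Fin (D1_order p) \<le> hord (D1 k f)" "(0, ones k) < D1_order p"
    using p(2) by (auto intro!: Fin_le_hordI D1_order_greater simp: hcoeff_D1_upto_order)
  then show ?thesis by (metis less_extended_simps(1) less_le_trans)
qed

section \<open>The differential equation\<close>

theorem propositionB3:
  fixes k :: nat and K M N T :: log_series and h :: "real fps"
  assumes "k \<ge> 1"
    and "K \<in> B_ge1_plus k" "M \<in> B_ge1_plus k" "N \<in> B_ge1_plus k" "T \<in> B_ge1_plus k"
    and "N \<noteq> 0"
    and "hord T \<ge> hord (D1 k N / N)"
    and "hord K > Fin (0, ones k)"
    and "hord M - hord N > Fin (0, ones k)"
    and "fps_X ^ 2 dvd h"
  shows "\<exists>!S. S \<in> B_ge1_plus k \<and> hord S > hord N \<and>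
    D1 k S - (D1 k N / N + K) * S + T * hahn_fps_eval h S = M"
proof -
  let ?H = "log_exponents k" and ?o = "(0, ones k) :: log_exponent"
  have B1: "K \<in> B1 k" "M \<in> B1 k" "N \<in> B1 k" "T \<in> B1 k"
    using assms by (auto simp: B_ge1_plus_def)
  obtain \<nu> where \<nu>: "\<nu> \<in> hsupp N" "hord N = Fin \<nu>"
    using hsupp_least[OF assms(6)] by blast
  have \<nu>H: "\<nu> \<in> ?H" "0 < \<nu>" and N0: "hcoeff N \<nu> \<noteq> 0"
    using \<nu> B1 assms(4) by (auto simp: B1_iff B_ge1_plus_def hsupp_def)
  have N_ge: "Fin \<nu> \<le> hord N" using \<nu> by simp
  have o_less: "?o < \<nu> + (0, ones (lead_index \<nu>))"
    using D1_order_greater[OF \<nu>H] by (simp add: D1_order_def)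
  \<comment> \<open>The product equals \<open>D1 k N\<close>, of order at least
    \<open>D1_order \<nu>\<close>; cancelling \<open>N\<close> leaves the vector of ones.\<close>
  have "Fin (\<nu> + (0, ones (lead_index \<nu>))) \<le> hord (N * (D1 k N / N))"
    using assms(6) by (auto intro!: Fin_le_hordI simp: hcoeff_D1_upto_order[OF \<nu>H N_ge] D1_order_def)
  then have "Fin (0, ones (lead_index \<nu>)) \<le> hord (D1 k N / N)"
    by (rule Fin_le_hord_cancel[OF \<nu>(2)])
  then have T_ge: "Fin (0, ones (lead_index \<nu>)) \<le> hord T" using assms(7) by (rule order_trans)
  have K_gt: "Fin ?o < hord K" by (rule assms(8))
  \<comment> \<open>The case split covers \<open>M = 0\<close>, whose order is infinite.\<close>
  have M_gt: "Fin (\<nu> + ?o) < hord M"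
    using assms(9) by (cases "hord M") (auto simp: \<nu>(2) less_diff_eq add.commute)
  \<comment> \<open>The residual after the substitution, once the terms with \<open>D1 k N\<close>
    have cancelled. It keeps the factor \<open>N\<close>, hence the shift by \<open>\<nu>\<close> in
    the exponents below.\<close>
  define \<Phi> where
    "\<Phi> Q = N * D1 k Q - K * (N * Q) + T * hahn_fps_eval h (N * Q) - M" for Q
  have transform: "D1 k (N * Q) - (D1 k N / N + K) * (N * Q) + T * hahn_fps_eval h (N * Q) - M = \<Phi> Q" for Q
    using assms(6) by (simp add: \<Phi>_def D1_times algebra_simps)
  have NQ_gt: "Fin \<nu> < hord (N * Q)" if "Fin 0 < hord Q" for Q
    using Fin_less_hord_times_right[OF N_ge that] by simp
  have \<Phi>_B1: "\<Phi> Q \<in> B1 k" and \<Phi>_gt: "Fin (\<nu> + ?o) < hord (\<Phi> Q)"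
    if Q: "Q \<in> B1 k" "Fin 0 < hord Q" for Q
  proof -
    have NQ: "Fin \<nu> < hord (N * Q)" "Fin 0 < hord (N * Q)"
      using NQ_gt[OF Q(2)] \<nu>H(2) by (auto intro: less_trans[of "Fin 0" "Fin \<nu>"])
    then show "\<Phi> Q \<in> B1 k"
      unfolding \<Phi>_def using B1 Q by (intro B1_diff B1_add B1_times B1_D1 B1_hahn_fps_eval)
    have "Fin (\<nu> + ?o) < hord (N * D1 k Q)"
      using N_ge Fin_less_hord_D1[OF Q] by (rule Fin_less_hord_times_right)
    moreover have "Fin (?o + \<nu>) < hord (K * (N * Q))"
      using K_gt less_imp_le[OF NQ(1)] by (rule Fin_less_hord_times_left)
    \<comment> \<open>Of the two copies of \<open>\<nu>\<close> coming from the square, one together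
      with the bound for \<open>T\<close> exceeds \<open>?o\<close>, by
      \<open>o_less\<close>.\<close>
    moreover have "Fin (\<nu> + ?o) < hord (T * hahn_fps_eval h (N * Q))"
    proof (rule less_trans)
      show "Fin ((0, ones (lead_index \<nu>)) + (\<nu> + \<nu>)) < hord (T * hahn_fps_eval h (N * Q))"
        using T_ge Fin_less_hord_hahn_fps_eval[OF NQ(1) less_imp_le[OF \<nu>H(2)] assms(10)]
        by (rule Fin_less_hord_times_right)
      show "Fin (\<nu> + ?o) < Fin ((0, ones (lead_index \<nu>)) + (\<nu> + \<nu>))"
        using add_strict_left_mono[OF o_less, of \<nu>] by (simp add: ac_simps)
    qed
    ultimately show "Fin (\<nu> + ?o) < hord (\<Phi> Q)"
      unfolding \<Phi>_def using M_gt by (intro Fin_less_hord_diff Fin_less_hord_add) (simp_all add: add.commute)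
  qed
  \<comment> \<open>The diagonal entry: the leading coefficient of \<open>N\<close> times the factor
    that the derivation puts on a leading term with exponent \<open>p\<close>.\<close>
  define c where
    "c p = hcoeff N \<nu> * real_of_int (Poly_Mapping.lookup (snd p) (lead_index p))" for p
  have c0: "c p \<noteq> 0" if "p \<in> ?H" "0 < p" for p
    using N0 lead_index(3)[OF that] by (simp add: c_def)
  have \<Phi>_diff: "hcoeff (\<Phi> Q - \<Phi> R) (\<nu> + D1_order p) = c p * hcoeff (Q - R) p"
    if Q: "Fin 0 < hord Q" and R: "Fin 0 < hord R" and p: "p \<in> ?H" "0 < p"
      and d: "Fin p \<le> hord (Q - R)" for Q R p
  proof -
    have \<Phi>: "\<Phi> Q - \<Phi> R = N * D1 k (Q - R) - K * (N * (Q - R)) +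
        T * (hahn_fps_eval h (N * Q) - hahn_fps_eval h (N * R))"
      by (simp add: \<Phi>_def D1_diff algebra_simps)
    have Nd: "Fin (\<nu> + p) \<le> hord (N * (Q - R))" using N_ge d by (rule Fin_le_hord_times)
    \<comment> \<open>The derivation raises \<open>p\<close> by at most \<open>?o\<close>, so a term
      of order above \<open>?o + (\<nu> + p)\<close> is invisible at the exponent under
      consideration.\<close>
    have le: "\<nu> + D1_order p \<le> ?o + (\<nu> + p)"
      using D1_order_le[OF p] by (simp add: ac_simps)
    have "hcoeff (N * D1 k (Q - R)) (\<nu> + D1_order p) = hcoeff N \<nu> * hcoeff (D1 k (Q - R)) (D1_order p)"
      by (intro hcoeff_times_least N_ge Fin_le_hordI) (auto simp: hcoeff_D1_upto_order[OF p d])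
    moreover have "hcoeff (K * (N * (Q - R))) (\<nu> + D1_order p) = 0"
      using Fin_less_hord_times_left[OF K_gt Nd] le by (rule hcoeff_eq_0_upto)
    moreover have "hcoeff (T * (hahn_fps_eval h (N * Q) - hahn_fps_eval h (N * R))) (\<nu> + D1_order p) = 0"
    proof (rule hcoeff_eq_0_upto)
      have "Fin (\<nu> + p) \<le> hord (N * Q - N * R)" using Nd by (simp add: algebra_simps)
      then show "Fin ((0, ones (lead_index \<nu>)) + (\<nu> + (\<nu> + p)))
          < hord (T * (hahn_fps_eval h (N * Q) - hahn_fps_eval h (N * R)))"
        using NQ_gt[OF Q] NQ_gt[OF R] \<nu>H(2) assms(10)
        by (intro Fin_less_hord_times_right[OF T_ge] Fin_less_hord_hahn_fps_eval_diff) auto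
      have "\<nu> + D1_order p \<le> \<nu> + (0, ones (lead_index \<nu>)) + (\<nu> + p)"
        by (rule order_trans[OF le add_right_mono[OF less_imp_le[OF o_less]]])
      also have "\<dots> = (0, ones (lead_index \<nu>)) + (\<nu> + (\<nu> + p))"
        by (simp only: add.commute[of \<nu> "(0, ones (lead_index \<nu>))"] add.assoc)
      finally show "\<nu> + D1_order p \<le> (0, ones (lead_index \<nu>)) + (\<nu> + (\<nu> + p))" .
    qed
    ultimately show ?thesis
      unfolding \<Phi> by (simp add: c_def hcoeff_D1_upto_order[OF p d])
  qed
  have X: "Q \<in> B1 k \<and> Fin 0 < hord Q" if "hsupp Q \<subseteq> {p \<in> ?H. 0 < p}" for Q
    using that by (auto simp: B1_iff Fin_less_hord_iff)
  have "\<exists>Q. hsupp Q \<subseteq> {p \<in> ?H. 0 < p} \<and> \<Phi> Q = 0"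
  proof (rule hahn_triangular_zero_exists)
    show "strict_mono_on {p \<in> ?H. 0 < p} (\<lambda>p. \<nu> + D1_order p)"
      using strict_mono_on_D1_order[of k] by (simp add: strict_mono_on_def)
    show "c p \<noteq> 0" if "p \<in> {p \<in> ?H. 0 < p}" for p using c0 that by blast
  next
    fix Q assume "hsupp Q \<subseteq> {p \<in> ?H. 0 < p}"
    then have Q: "Q \<in> B1 k" "Fin 0 < hord Q" using X by auto
    show "hsupp (\<Phi> Q) \<subseteq> (\<lambda>p. \<nu> + D1_order p) ` {p \<in> ?H. 0 < p}"
    proof
      fix m assume "m \<in> hsupp (\<Phi> Q)"
      then have "m \<in> ?H" "\<nu> + ?o < m"
        using \<Phi>_B1[OF Q] \<Phi>_gt[OF Q] by (auto simp: B1_iff Fin_less_hord_iff)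
      \<comment> \<open>After removing the shift, the exponent lies in the group and above
        \<open>(0, ones k)\<close>, so it has a preimage under \<open>D1_order\<close>.\<close>
      then have "m - \<nu> \<in> D1_order ` {p \<in> ?H. 0 < p}"
        using \<nu>H by (intro in_image_D1_order log_exponents_group) (simp_all add: less_diff_eq add.commute)
      then show "m \<in> (\<lambda>p. \<nu> + D1_order p) ` {p \<in> ?H. 0 < p}"
        by (auto simp: image_iff diff_eq_eq add.commute)
    qed
  next
    fix Q R p assume "hsupp Q \<subseteq> {p \<in> ?H. 0 < p}" "hsupp R \<subseteq> {p \<in> ?H. 0 < p}"
      "p \<in> {p \<in> ?H. 0 < p}" "\<And>s. s < p \<Longrightarrow> hcoeff Q s = hcoeff R s"
    then have "hcoeff (\<Phi> Q - \<Phi> R) (\<nu> + D1_order p) = c p * hcoeff (Q - R) p"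
      using X by (intro \<Phi>_diff Fin_le_hordI) auto
    then show "hcoeff (\<Phi> Q) (\<nu> + D1_order p) - hcoeff (\<Phi> R) (\<nu> + D1_order p)
        = c p * (hcoeff Q p - hcoeff R p)" by simp
  qed
  then obtain Q where Q: "hsupp Q \<subseteq> {p \<in> ?H. 0 < p}" "\<Phi> Q = 0" by blast
  show ?thesis
  proof (rule ex1I)
    have "Fin \<nu> < hord (N * Q)" "N * Q \<in> B1 k"
      using X[OF Q(1)] NQ_gt B1 by (auto intro: B1_times)
    moreover from this have "Fin 0 < hord (N * Q)" using \<nu>H(2) by (auto intro: less_trans[of "Fin 0" "Fin \<nu>"])
    ultimately show "N * Q \<in> B_ge1_plus k \<and> hord (N * Q) > hord N \<and>
        D1 k (N * Q) - (D1 k N / N + K) * (N * Q) + T * hahn_fps_eval h (N * Q) = M"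
      using transform[of Q] Q(2) \<nu>(2) by (simp add: B_ge1_plus_def)
  next
    fix S assume "S \<in> B_ge1_plus k \<and> hord S > hord N \<and>
      D1 k S - (D1 k N / N + K) * S + T * hahn_fps_eval h S = M"
    then have S_B: "S \<in> B1 k" and S_gt: "hord N < hord S"
      and S_eq: "D1 k S - (D1 k N / N + K) * S + T * hahn_fps_eval h S = M"
      by (simp_all add: B_ge1_plus_def)
    \<comment> \<open>Undoing the substitution turns \<open>S\<close> into a zero of
      \<open>\<Phi>\<close> of positive order, to be compared with \<open>Q\<close>.\<close>
    define R where "R = S / N"
    have NR: "S = N * R" using assms(6) by (simp add: R_def)
    have R: "Fin 0 < hord R"
    proof (rule Fin_less_hord_cancel[OF \<nu>(2)])
      show "Fin (\<nu> + 0) < hord (N * R)" using S_gt by (simp only: NR[symmetric] \<nu>(2) add_0_right)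
    qed
    have \<Phi>R: "\<Phi> R = 0"
      using S_eq transform[of R] by (simp only: NR[symmetric] diff_self)
    show "S = N * Q"
    proof (rule ccontr)
      assume "S \<noteq> N * Q"
      then have "R - Q \<noteq> 0" by (auto simp: NR)
      then obtain p where p: "p \<in> hsupp (R - Q)" "hord (R - Q) = Fin p" using hsupp_least by blast
      \<comment> \<open>That \<open>p\<close> lies in the exponent group is read off from
        \<open>S - N * Q\<close>, which lies in \<open>B1 k\<close>. This avoids closure of
        \<open>B1 k\<close> under the division that produced \<open>R\<close>.\<close>
      have "\<nu> + p \<in> hsupp (S - N * Q)"
        using add_in_hsupp_times[OF \<nu>(2) p(2)] by (simp add: NR algebra_simps)
      moreover have "S - N * Q \<in> B1 k" using S_B X[OF Q(1)] B1 by (auto intro: B1_diff B1_times)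
      ultimately have "\<nu> + p - \<nu> \<in> ?H" using \<nu>H(1) unfolding B1_iff by (blast intro: log_exponents_group)
      then have pH: "p \<in> ?H" by simp
      have "Fin 0 < hord (R - Q)" using R X[OF Q(1)] by (blast intro: Fin_less_hord_diff)
      then have p0: "0 < p" using p(2) by simp
      \<comment> \<open>Both residuals vanish, so the difference formula at the leading exponent
        \<open>p\<close> of \<open>R - Q\<close> makes a product of two nonzero reals zero.\<close>
      have "c p * hcoeff (R - Q) p = 0"
        using \<Phi>_diff[OF R _ pH p0, of Q] X[OF Q(1)] p(2) \<Phi>R Q(2) by simp
      then show False using c0[OF pH p0] p(1) by (simp add: hsupp_def)
    qed
  qed
qed

end
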